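(* Let $r,s,t>0$. For every $\mathbf{\Phi}=(\Phi_1,\Phi_2,\Phi_3)\in\mathcal{O}_{r,s,t}$ there exist numbers $\theta_j\in\mathbb{R}$ and real functions $\phi_j$, $j=1,2,3$, such that $\phi_j(x)>0$ for all $x\in\mathbb{R}$ and $$\Phi_j(x)=e^{i\theta_j}\phi_j(x),\qquad j=1,2,3.$$ Furthermore, $\Phi_1,\Phi_2,\Phi_3$ are infinitely differentiable on $\mathbb{R}$.
   Context: Standing assumptions: $p\in[2,3)$, and $a_{kj}$ ($k,j\in\{1,2,3\}$) are positive real constants with $a_{kj}=a_{jk}$. Notation: $H^1=H^1(\mathbb{R})$ is the Sobolev space of complex-valued functions on $\mathbb{R}$; $\|f\|$ denotes the $L^2(\mathbb{R})$ norm; $Y=H^1\times H^1\times H^1$. As usual, elements of $H^1$ are identified with their continuous representatives. For $\mathbf{f}=(f_1,f_2,f_3)\in Y$ set $$\mathcal{H}(\mathbf{f})=\int_{-\infty}^{\infty}\Big(\sum_{j=1}^{3}|f_j'|^2-\frac1p\sum_{k,j=1}^{3}a_{kj}|f_k|^p|f_j|^p\Big)dx.$$ For $r,s,t>0$ set $\Delta_{r,s,t}=\{\mathbf{f}\in Y:\|f_1\|^2=r,\ \|f_2\|^2=s,\ \|f_3\|^2=t\}$, $\lambda(r,s,t)=\inf\{\mathcal{H}(\mathbf{f}):\mathbf{f}\in\Delta_{r,s,t}\}$, and $\mathcal{O}_{r,s,t}=\{\mathbf{\Phi}\in\Delta_{r,s,t}:\mathcal{H}(\mathbf{\Phi})=\lambda(r,s,t)\}$.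 *)

theory Defs
  imports "HOL-Analysis.Analysis"
begin

definition infinitely_differentiable :: "(real \<Rightarrow> 'a::real_normed_vector) \<Rightarrow> bool" where
  "infinitely_differentiable f \<longleftrightarrow>
     (\<exists>D :: nat \<Rightarrow> real \<Rightarrow> 'a. D 0 = f \<and> (\<forall>n x. (D n has_vector_derivative D (Suc n) x) (at x)))"

definition test_functions :: "(real \<Rightarrow> real) set" where
  "test_functions = {\<psi>. infinitely_differentiable \<psi> \<and> compact (closure {x. \<psi> x \<noteq> 0})}"

definition square_integrable :: "(real \<Rightarrow> complex) \<Rightarrow> bool" where
  "square_integrable f \<longleftrightarrow>
     f \<in> borel_measurable lborel \<and> integrable lborel (\<lambda>x. (cmod (f x))\<^sup>2)"

definition norm_L2 :: "(real \<Rightarrow> complex) \<Rightarrow> real" where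
  "norm_L2 f = sqrt (LINT x|lborel. (cmod (f x))\<^sup>2)"

definition is_weak_derivative_L2 :: "(real \<Rightarrow> complex) \<Rightarrow> (real \<Rightarrow> complex) \<Rightarrow> bool" where
  "is_weak_derivative_L2 f g \<longleftrightarrow> square_integrable g \<and>
     (\<forall>\<psi>\<in>test_functions.
        (LINT x|lborel. deriv \<psi> x *\<^sub>R f x) = - (LINT x|lborel. \<psi> x *\<^sub>R g x))"

text \<open>An element of \<open>H\<^sup>1(\<real>)\<close> is represented by its unique continuous representative.\<close>

definition H1 :: "(real \<Rightarrow> complex) set" where
  "H1 = {f. continuous_on UNIV f \<and> square_integrable f \<and> (\<exists>g. is_weak_derivative_L2 f g)}"

text \<open>The weak derivative is determined only almost everywhere; the choice is immaterial
  because it is used under the integral sign only.\<close>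

definition weak_derivative :: "(real \<Rightarrow> complex) \<Rightarrow> real \<Rightarrow> complex" where
  "weak_derivative f = (SOME g. is_weak_derivative_L2 f g)"

text \<open>The index set \<open>{1, 2, 3}\<close> is the three-element type \<^typ>\<open>3\<close>, whose elements are
  \<open>1\<close>, \<open>2\<close> and \<open>3\<close> (with \<open>3 = 0\<close>).\<close>

definition Y :: "(3 \<Rightarrow> real \<Rightarrow> complex) set" where
  "Y = {f. \<forall>j. f j \<in> H1}"

definition energy :: "real \<Rightarrow> (3 \<Rightarrow> 3 \<Rightarrow> real) \<Rightarrow> (3 \<Rightarrow> real \<Rightarrow> complex) \<Rightarrow> real" where
  "energy p a f =
     (LINT x|lborel. (\<Sum>j\<in>UNIV. (cmod (weak_derivative (f j) x))\<^sup>2)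
        - 1 / p * (\<Sum>k\<in>UNIV. \<Sum>j\<in>UNIV. a k j * cmod (f k x) powr p * cmod (f j x) powr p))"

definition constraint_set :: "real \<Rightarrow> real \<Rightarrow> real \<Rightarrow> (3 \<Rightarrow> real \<Rightarrow> complex) set" where
  "constraint_set r s t =
     {f \<in> Y. (norm_L2 (f 1))\<^sup>2 = r \<and> (norm_L2 (f 2))\<^sup>2 = s \<and> (norm_L2 (f 3))\<^sup>2 = t}"

text \<open>The infimum is taken in the extended reals, so that it is the true infimum without
  prior knowledge that the energy is bounded below on the constraint set.\<close>

definition min_energy :: "real \<Rightarrow> (3 \<Rightarrow> 3 \<Rightarrow> real) \<Rightarrow> real \<Rightarrow> real \<Rightarrow> real \<Rightarrow> ereal" where
  "min_energy p a r s t = (INF f\<in>constraint_set r s t. ereal (energy p a f))"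

definition minimizers ::
  "real \<Rightarrow> (3 \<Rightarrow> 3 \<Rightarrow> real) \<Rightarrow> real \<Rightarrow> real \<Rightarrow> real \<Rightarrow> (3 \<Rightarrow> real \<Rightarrow> complex) set" where
  "minimizers p a r s t =
     {\<Phi> \<in> constraint_set r s t. ereal (energy p a \<Phi>) = min_energy p a r s t}"

end

theory Submission imports Defs begin

text \<open>
  Freeze all components of the minimizer but the \<open>j\<close>-th. What remains is a one-component problem:
  \<open>f\<close> minimizes \<open>\<integral> |f'|\<^sup>2 - 1/p (\<alpha> |f|\<^sup>2\<^sup>p + 2 W |f|\<^sup>p)\<close> at fixed \<open>L\<^sup>2\<close> norm, with a
  bounded continuous weight \<open>W \<ge> 0\<close>. Since \<open>|z|\<^sup>q\<close> lies above its tangents, the energy of the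
  renormalized perturbation \<open>f + \<epsilon> h\<close> is bounded above by an explicit differentiable function of
  \<open>\<epsilon>\<close> with equality at \<open>\<epsilon> = 0\<close>, which yields the Euler--Lagrange equation without differentiating
  under the integral. Tested against tents \<open>h\<close>, it says that the difference quotients of \<open>f\<close>
  agree with those of a \<open>C\<^sup>2\<close> function, so \<open>f'' = (\<omega> - V) f\<close> holds classically.

  The modulus \<open>|f|\<close> has no larger Dirichlet integral, hence is a minimizer as well and solves an
  equation of the same type; being nonnegative and not identically zero, it has no zeros by
  uniqueness for the initial value problem. Equality of the two Dirichlet integrals then forces
  \<open>f / |f|\<close> to be constant. Smoothness follows by differentiating the system repeatedly, because
  real powers of positive functions are smooth.
\<close>

section \<open>Smooth functions and cutoffs\<close>

text \<open>The power terms enter the energy with a minus sign and nonnegative coefficients, so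
  replacing them by their tangents, which lie below, raises the energy. An upper bound that touches
  at 0 and is differentiable there is all that a minimum needs, and the renormalization produces the
  Lagrange multiplier in closed form. Regularity comes in two stages. The weight is at first only
  known to be continuous, and real powers of |f| need not be smooth at zeros of f. Hence no more
  than C^2 is claimed until all three components are known to be positive; smoothness is then proved
  for the three moduli at once. The bound 2 <= p keeps |f|^(p-2) bounded. The equation is thus
  linear in f with a bounded coefficient, which is what excludes double zeros. Weak derivatives are
  defined through smooth test functions, whereas the convenient tests are tents. The bridge is the
  fundamental theorem of calculus for weak derivatives, and a smooth step is constructed to prove
  it.\<close>

text \<open>The definition asks for a whole sequence of derivatives, whereas stability under one
  differentiation is what can be checked. Choosing a derivative in \<open>P\<close> for each member
  of \<open>P\<close> and iterating the choice gives the sequence.\<close>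

lemma infinitely_differentiableI_coinduct:
  fixes f :: "real \<Rightarrow> 'a::real_normed_vector"
  assumes "P f"
    and "\<And>f. P f \<Longrightarrow> \<exists>f'. P f' \<and> (\<forall>x. (f has_vector_derivative f' x) (at x))"
  shows "infinitely_differentiable f"
proof -
  from assms(2) obtain d
    where d: "\<And>f. P f \<Longrightarrow> P (d f) \<and> (\<forall>x. (f has_vector_derivative d f x) (at x))"
    by metis
  have P: "P ((d ^^ n) f)" for n
    by (induct n) (use assms(1) d in auto)
  show ?thesis
    unfolding infinitely_differentiable_def
    by (intro exI[of _ "\<lambda>n. (d ^^ n) f"]) (use d P in auto)
qed

lemma infinitely_differentiableE:
  assumes "infinitely_differentiable f"
  obtains f' where "infinitely_differentiable f'" "\<And>x. (f has_vector_derivative f' x) (at x)"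
proof -
  obtain D where D: "D 0 = f" "\<And>n x. (D n has_vector_derivative D (Suc n) x) (at x)"
    using assms unfolding infinitely_differentiable_def by auto
  have "infinitely_differentiable (D 1)"
    unfolding infinitely_differentiable_def
    by (intro exI[of _ "\<lambda>n. D (Suc n)"]) (use D in auto)
  with that D(2)[of 0] D(1) show ?thesis by simp
qed

lemma infinitely_differentiable_cont:
  assumes "infinitely_differentiable f"
  shows "continuous_on A f"
proof -
  obtain f' where "\<And>x. (f has_vector_derivative f' x) (at x)"
    using assms by (blast elim: infinitely_differentiableE)
  then show ?thesis
    by (intro continuous_at_imp_continuous_on ballI) (rule has_vector_derivative_continuous)
qed

lemma infinitely_differentiable_add:
  assumes "infinitely_differentiable f" "infinitely_differentiable g"
  shows "infinitely_differentiable (\<lambda>x. f x + g x)"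
proof (rule infinitely_differentiableI_coinduct[where
      P = "\<lambda>h. \<exists>f g. infinitely_differentiable f \<and> infinitely_differentiable g \<and> h = (\<lambda>x. f x + g x)"])
  fix h :: "real \<Rightarrow> 'a"
  assume "\<exists>f g. infinitely_differentiable f \<and> infinitely_differentiable g \<and> h = (\<lambda>x. f x + g x)"
  then obtain f g where *: "infinitely_differentiable f" "infinitely_differentiable g" "h = (\<lambda>x. f x + g x)"
    by auto
  obtain f' where f': "infinitely_differentiable f'" "\<And>x. (f has_vector_derivative f' x) (at x)"
    using *(1) by (blast elim: infinitely_differentiableE)
  obtain g' where g': "infinitely_differentiable g'" "\<And>x. (g has_vector_derivative g' x) (at x)"
    using *(2) by (blast elim: infinitely_differentiableE)
  show "\<exists>h'. (\<exists>f g. infinitely_differentiable f \<and> infinitely_differentiable g \<and> h' = (\<lambda>x. f x + g x))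
       \<and> (\<forall>x. (h has_vector_derivative h' x) (at x))"
    unfolding *(3) using f' g'
    by (intro exI[of _ "\<lambda>x. f' x + g' x"]) (auto intro!: derivative_intros)
qed (use assms in auto)

lemma infinitely_differentiable_compose_linear:
  assumes "infinitely_differentiable f" "bounded_linear T"
  shows "infinitely_differentiable (\<lambda>x. T (f x))"
proof -
  obtain D where D: "D 0 = f" "\<And>n x. (D n has_vector_derivative D (Suc n) x) (at x)"
    using assms unfolding infinitely_differentiable_def by auto
  show ?thesis
    unfolding infinitely_differentiable_def
    by (intro exI[of _ "\<lambda>n x. T (D n x)"])
       (use D bounded_linear.has_vector_derivative[OF assms(2)] in auto)
qed

lemma infinitely_differentiable_compose_affine:
  fixes f :: "real \<Rightarrow> 'a::real_normed_vector"
  assumes "infinitely_differentiable f"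
  shows "infinitely_differentiable (\<lambda>x. f (m * x + c))"
proof -
  obtain D where D: "D 0 = f" "\<And>n x. (D n has_vector_derivative D (Suc n) x) (at x)"
    using assms unfolding infinitely_differentiable_def by auto
  have "((\<lambda>x. m ^ n *\<^sub>R D n (m * x + c)) has_vector_derivative m ^ Suc n *\<^sub>R D (Suc n) (m * x + c)) (at x)" for n x
  proof -
    have "((\<lambda>x. m * x + c) has_vector_derivative m) (at x)"
      by (auto intro!: derivative_eq_intros simp: has_real_derivative_iff_has_vector_derivative[symmetric])
    from vector_diff_chain_at[OF this D(2)[of n]]
    have "((\<lambda>x. D n (m * x + c)) has_vector_derivative m *\<^sub>R D (Suc n) (m * x + c)) (at x)"
      by (simp add: o_def)
    then show ?thesis
      by (auto intro!: derivative_eq_intros simp: mult.commute)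
  qed
  then show ?thesis
    unfolding infinitely_differentiable_def
    by (intro exI[of _ "\<lambda>n x. m ^ n *\<^sub>R D n (m * x + c)"]) (use D in auto)
qed

text \<open>Single products are not stable under differentiation, but finite sums of products are,
  by the Leibniz rule; this is the invariant for the coinduction below.\<close>

inductive sum_of_smooth_products :: "(real \<Rightarrow> real) \<Rightarrow> bool" where
  prod: "infinitely_differentiable f \<Longrightarrow> infinitely_differentiable g
    \<Longrightarrow> sum_of_smooth_products (\<lambda>x. f x * g x)"
| sum: "sum_of_smooth_products f \<Longrightarrow> sum_of_smooth_products g
    \<Longrightarrow> sum_of_smooth_products (\<lambda>x. f x + g x)"

lemma infinitely_differentiable_mult:
  fixes f g :: "real \<Rightarrow> real"
  assumes "infinitely_differentiable f" "infinitely_differentiable g"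
  shows "infinitely_differentiable (\<lambda>x. f x * g x)"
proof (rule infinitely_differentiableI_coinduct[where P = sum_of_smooth_products])
  fix h assume "sum_of_smooth_products h"
  then show "\<exists>h'. sum_of_smooth_products h' \<and> (\<forall>x. (h has_vector_derivative h' x) (at x))"
  proof induction
    case (prod f g)
    obtain f' where f': "infinitely_differentiable f'" "\<And>x. (f has_vector_derivative f' x) (at x)"
      using prod(1) by (blast elim: infinitely_differentiableE)
    obtain g' where g': "infinitely_differentiable g'" "\<And>x. (g has_vector_derivative g' x) (at x)"
      using prod(2) by (blast elim: infinitely_differentiableE)
    show ?case
      using f' g' prod
      by (intro exI[of _ "\<lambda>x. f x * g' x + f' x * g x"])
         (auto intro!: sum_of_smooth_products.intros derivative_intros)
  next
    case (sum f g)
    then obtain f' g' where "sum_of_smooth_products f'" "\<And>x. (f has_vector_derivative f' x) (at x)"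
      "sum_of_smooth_products g'" "\<And>x. (g has_vector_derivative g' x) (at x)" by auto
    then show ?case
      by (intro exI[of _ "\<lambda>x. f' x + g' x"])
         (auto intro!: sum_of_smooth_products.intros derivative_intros)
  qed
qed (use assms in \<open>auto intro: sum_of_smooth_products.intros\<close>)

section \<open>A smooth step from functions that are flat at the origin\<close>

text \<open>With u = 1/x this is u^k e^(-u), extended by 0; \<open>k = 0\<close> is the classical
  exp(-1/x). The powers are carried along because differentiation produces them.\<close>

definition flat_base :: "nat \<Rightarrow> real \<Rightarrow> real" where
  "flat_base k x = (if x > 0 then (1 / x) ^ k / exp (1 / x) else 0)"

inductive flat_fun :: "(real \<Rightarrow> real) \<Rightarrow> bool" where
  base: "flat_fun (flat_base k)"
| scale: "flat_fun f \<Longrightarrow> flat_fun (\<lambda>x. c * f x)"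
| sum: "flat_fun f \<Longrightarrow> flat_fun g \<Longrightarrow> flat_fun (\<lambda>x. f x + g x)"

lemma flat_base_tendsto_0: "(flat_base k \<longlongrightarrow> 0) (at 0)"
proof -
  have "((\<lambda>x. (inverse x) ^ k / exp (inverse x)) \<longlongrightarrow> (0::real)) (at_right 0)"
    by (rule filterlim_compose[OF tendsto_power_div_exp_0 filterlim_inverse_at_top_right])
  then have "(flat_base k \<longlongrightarrow> 0) (at_right 0)"
    by (rule Lim_transform_eventually)
       (auto simp: eventually_at_filter flat_base_def inverse_eq_divide)
  moreover have "(flat_base k \<longlongrightarrow> 0) (at_left 0)"
    by (rule tendsto_eventually) (auto simp: eventually_at_filter flat_base_def)
  ultimately show ?thesis
    by (simp add: filterlim_at_split)
qed

lemma flat_base_has_derivative: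
  "(flat_base k has_real_derivative (flat_base (k + 2) x + (- real k) * flat_base (k + 1) x)) (at x)"
proof (cases x "0::real" rule: linorder_cases)
  case less
  have "((\<lambda>x. 0) has_real_derivative 0) (at x)" by simp
  then have "(flat_base k has_real_derivative 0) (at x)"
    by (rule has_field_derivative_transform_within_open[where S="{..<0}"])
       (use less in \<open>auto simp: flat_base_def\<close>)
  then show ?thesis using less by (simp add: flat_base_def)
next
  case equal
  \<comment> \<open>Division by h turns \<open>flat_base k\<close> into
    \<open>flat_base (k + 1)\<close>, which tends to 0.\<close>
  have "((\<lambda>h. (flat_base k (0 + h) - flat_base k 0) / h) \<longlongrightarrow> 0) (at 0)"
    using flat_base_tendsto_0[of "k+1"]
    by (rule Lim_transform_eventually)
       (auto simp: eventually_at_filter flat_base_def)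
  then show ?thesis using equal by (simp add: DERIV_def flat_base_def)
next
  case greater
  define u where "u = 1 / x"
  \<comment> \<open>For \<open>k = 0\<close> the exponent \<open>k - 1\<close> is truncated to 0;
    the factor \<open>real k\<close> makes this harmless.\<close>
  have k: "real k * u ^ (k - 1) * u = real k * u ^ k"
    by (cases k) auto
  have "((\<lambda>t. t ^ k / exp t) has_real_derivative (real k * u ^ (k - 1) - u ^ k) / exp u) (at u)"
    by (auto intro!: derivative_eq_intros simp: field_simps)
  moreover have "((\<lambda>x. 1 / x) has_real_derivative - (u * u)) (at x)"
    using greater by (auto intro!: derivative_eq_intros simp: u_def)
  ultimately have "((\<lambda>x. (1 / x) ^ k / exp (1 / x)) has_real_derivative
      (real k * u ^ (k - 1) - u ^ k) / exp u * - (u * u)) (at x)"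
    unfolding u_def by (rule DERIV_chain2)
  also have "(real k * u ^ (k - 1) - u ^ k) / exp u * - (u * u)
      = (u ^ (k + 2) - (real k * u ^ (k - 1) * u) * u) / exp u"
    by (simp add: algebra_simps diff_divide_distrib add_divide_distrib)
  also have "\<dots> = flat_base (k + 2) x + (- real k) * flat_base (k + 1) x"
    unfolding k using greater by (simp add: flat_base_def u_def diff_divide_distrib)
  finally have "((\<lambda>x. (1 / x) ^ k / exp (1 / x)) has_real_derivative
      flat_base (k + 2) x + (- real k) * flat_base (k + 1) x) (at x)" .
  then show ?thesis
    by (rule has_field_derivative_transform_within_open[where S="{0<..}"])
       (use greater in \<open>auto simp: flat_base_def\<close>)
qed

lemma infinitely_differentiable_flat_base: "infinitely_differentiable (flat_base k)"
proof (rule infinitely_differentiableI_coinduct[where P = flat_fun])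
  fix f assume "flat_fun f"
  then show "\<exists>f'. flat_fun f' \<and> (\<forall>x. (f has_vector_derivative f' x) (at x))"
  proof induction
    case (base k)
    show ?case
      by (intro exI[of _ "\<lambda>x. flat_base (k + 2) x + (- real k) * flat_base (k + 1) x"] conjI allI
          flat_fun.intros flat_base_has_derivative[unfolded has_real_derivative_iff_has_vector_derivative])
  next
    case (scale f c)
    then obtain f' where "flat_fun f'" "\<And>x. (f has_vector_derivative f' x) (at x)" by auto
    then show ?case
      by (intro exI[of _ "\<lambda>x. c * f' x"]) (auto intro!: flat_fun.intros derivative_intros)
  next
    case (sum f g)
    then obtain f' g' where "flat_fun f'" "\<And>x. (f has_vector_derivative f' x) (at x)"
      "flat_fun g'" "\<And>x. (g has_vector_derivative g' x) (at x)" by auto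
    then show ?case
      by (intro exI[of _ "\<lambda>x. f' x + g' x"]) (auto intro!: flat_fun.intros derivative_intros)
  qed
qed (auto intro: flat_fun.intros)

text \<open>\<open>S\<close> is the normalized antiderivative of a bump supported in [0, 1], and
  \<rho> is the normalized bump. \<open>S\<close> will smooth the indicators of intervals, \<rho>
  will act as mollifier.\<close>

lemma smooth_step_exists:
  obtains S \<rho> :: "real \<Rightarrow> real"
  where "infinitely_differentiable S" "\<And>x. (S has_real_derivative \<rho> x) (at x)"
    "\<And>x. 0 \<le> \<rho> x" "\<And>x. x \<notin> {0..1} \<Longrightarrow> \<rho> x = 0" "continuous_on UNIV \<rho>"
    "\<And>x. x \<le> 0 \<Longrightarrow> S x = 0" "\<And>x. x \<ge> 1 \<Longrightarrow> S x = 1" "\<And>x. 0 \<le> S x" "\<And>x. S x \<le> 1"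
proof -
  define \<beta> where "\<beta> x = flat_base 0 x * flat_base 0 (-1 * x + 1)" for x
  have smooth: "infinitely_differentiable \<beta>"
    unfolding \<beta>_def
    by (intro infinitely_differentiable_mult infinitely_differentiable_compose_affine
        infinitely_differentiable_flat_base)
  have pos: "\<beta> x > 0" if "0 < x" "x < 1" for x
    using that by (auto simp: \<beta>_def flat_base_def)
  have nonneg: "\<beta> x \<ge> 0" for x by (auto simp: \<beta>_def flat_base_def)
  have zero: "\<beta> x = 0" if "x \<le> 0 \<or> 1 \<le> x" for x using that by (auto simp: \<beta>_def flat_base_def)
  have "\<exists>F. \<forall>x. - \<infinity> < ereal x \<longrightarrow> ereal x < \<infinity> \<longrightarrow> (F has_vector_derivative \<beta> x) (at x)"
    by (rule einterval_antiderivative)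
       (use infinitely_differentiable_cont[OF smooth, of UNIV] in \<open>auto simp: continuous_on_eq_continuous_at\<close>)
  then obtain F where F: "\<And>x. (F has_real_derivative \<beta> x) (at x)"
    by (auto simp: has_real_derivative_iff_has_vector_derivative)
  have contF: "continuous_on A F" for A
    using F by (meson DERIV_continuous continuous_at_imp_continuous_on)
  have mono: "F x \<le> F y" if "x \<le> y" for x y
    using DERIV_nonneg_imp_nondecreasing[OF that, of F] F nonneg by blast
  have F01: "F 0 < F 1"
    by (rule DERIV_pos_imp_increasing_open) (use F pos contF in auto)
  have flat: "(F has_real_derivative 0) (at x)" if "x \<le> 0 \<or> 1 \<le> x" for x
    using F[of x] zero[OF that] by simp
  have F0: "F x = F 0" if "x \<le> 0" for x
    using DERIV_isconst2[of x 0 F 0] flat contF that by (cases "x = 0") auto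
  have F1: "F x = F 1" if "x \<ge> 1" for x
    using DERIV_isconst2[of 1 x F x] flat contF that by (cases "x = 1") auto
  define m where "m = 1 / (F 1 - F 0)"
  have m: "m > 0" using F01 by (simp add: m_def)
  define S where "S x = m * (F x - F 0)" for x
  have dS: "(S has_real_derivative m * \<beta> x) (at x)" for x
    unfolding S_def using F by (auto intro!: derivative_eq_intros)
  obtain D where D: "D 0 = \<beta>" "\<And>n x. (D n has_vector_derivative D (Suc n) x) (at x)"
    using smooth unfolding infinitely_differentiable_def by auto
  have smS: "infinitely_differentiable S"
    unfolding infinitely_differentiable_def
  \<comment> \<open>The derivatives of \<beta>, scaled by \<open>m\<close> and shifted by one place,
    with \<open>S\<close> put in front.\<close>
  proof (intro exI[of _ "\<lambda>n. case n of 0 \<Rightarrow> S | Suc k \<Rightarrow> (\<lambda>x. m * D k x)"] conjI allI)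
    fix n x
    show "((case n of 0 \<Rightarrow> S | Suc k \<Rightarrow> \<lambda>x. m * D k x) has_vector_derivative
        (case Suc n of 0 \<Rightarrow> S | Suc k \<Rightarrow> \<lambda>x. m * D k x) x) (at x)"
      using D dS by (cases n) (auto simp: has_real_derivative_iff_has_vector_derivative intro!: derivative_intros)
  qed auto
  have cont\<beta>: "continuous_on UNIV (\<lambda>x. m * \<beta> x)"
    by (intro continuous_intros infinitely_differentiable_cont smooth)
  have S1: "S x = 1" if "x \<ge> 1" for x
    unfolding S_def F1[OF that] using F01 by (simp add: m_def)
  have S0: "S x = 0" if "x \<le> 0" for x
    unfolding S_def F0[OF that] by simp
  have monoS: "S x \<le> S y" if "x \<le> y" for x y
    unfolding S_def using mono[OF that] m by simp
  have "0 \<le> S x" "S x \<le> 1" for x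
    using S0[of "min x 0"] S1[of "max x 1"] monoS[of "min x 0" x] monoS[of x "max x 1"] by auto
  moreover have "0 \<le> m * \<beta> x" for x
    using m nonneg by simp
  moreover have "m * \<beta> x = 0" if "x \<notin> {0..1}" for x
    using zero[of x] that by auto
  ultimately show ?thesis
    by (intro that[of S "\<lambda>x. m * \<beta> x"] smS dS cont\<beta> S0 S1)
qed

section \<open>Weak derivatives and the fundamental theorem of calculus\<close>

text \<open>The gauge integral satisfies the fundamental theorem for every derivative; integrability
  then transfers it to the Lebesgue integral. The exceptional set \<open>S\<close> admits the kinks
  of tents.\<close>

lemma FTC_lborel:
  fixes F :: "real \<Rightarrow> 'a::euclidean_space"
  assumes "finite S" "a \<le> b" "\<And>x. x \<in> {a..b} - S \<Longrightarrow> (F has_vector_derivative g x) (at x)"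
    and "continuous_on {a..b} F" and "integrable lborel (\<lambda>x. indicator {a..b} x *\<^sub>R g x)"
  shows "(LINT x|lborel. indicator {a..b} x *\<^sub>R g x) = F b - F a"
proof -
  have "(g has_integral F b - F a) {a..b}"
    by (rule fundamental_theorem_of_calculus_strong[OF assms(1-4)])
  then have "((\<lambda>x. indicator {a..b} x *\<^sub>R g x) has_integral F b - F a) UNIV"
    unfolding indicator_scaleR_eq_if by (simp only: has_integral_restrict_UNIV)
  then show ?thesis
    using has_integral_integral_lborel[OF assms(5)] has_integral_unique by blast
qed

lemma square_integrable_mult_bounded_support:
  fixes \<psi> :: "real \<Rightarrow> real"
  assumes "square_integrable g" "\<psi> \<in> borel_measurable borel" "\<And>x. \<bar>\<psi> x\<bar> \<le> K * indicator {a..b} x"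
  shows "integrable lborel (\<lambda>x. \<psi> x *\<^sub>R g x)"
proof (rule Bochner_Integration.integrable_bound)
  have "integrable lborel (\<lambda>x. indicator {a..b} x :: real)"
    by (cases "a \<le> b") auto
  then show "integrable lborel (\<lambda>x. K * (indicator {a..b} x + (cmod (g x))\<^sup>2))"
    using assms(1) by (auto simp: square_integrable_def)
  show "(\<lambda>x. \<psi> x *\<^sub>R g x) \<in> borel_measurable lborel"
    using assms by (auto simp: square_integrable_def)
  show "AE x in lborel. norm (\<psi> x *\<^sub>R g x) \<le> norm (K * (indicator {a..b} x + (cmod (g x))\<^sup>2))"
  proof (rule AE_I2)
    fix x
    show "norm (\<psi> x *\<^sub>R g x) \<le> norm (K * (indicator {a..b} x + (cmod (g x))\<^sup>2))"
    proof (cases "x \<in> {a..b}")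
      case True
      have K: "0 \<le> K" using assms(3)[of x] True by simp
      \<comment> \<open>On a bounded interval t <= 1 + t^2 takes the place of
        Cauchy-Schwarz.\<close>
      have "cmod (g x) \<le> 1 + (cmod (g x))\<^sup>2"
        using zero_le_power2[of "cmod (g x) - 1"] by (simp add: power2_diff) (smt (verit) norm_ge_zero)
      then have "\<bar>\<psi> x\<bar> * cmod (g x) \<le> K * (1 + (cmod (g x))\<^sup>2)"
        using assms(3)[of x] True K by (intro mult_mono) auto
      then show ?thesis using True K by simp
    next
      case False
      then show ?thesis using assms(3)[of x] by simp
    qed
  qed
qed

lemma square_integrable_restrict_integrable:
  assumes "square_integrable g"
  shows "integrable lborel (\<lambda>x. indicator {a..b} x *\<^sub>R g x)"
  by (rule square_integrable_mult_bounded_support[OF assms, of _ 1 a b]) auto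

lemma continuous_bounded_Icc:
  fixes f :: "real \<Rightarrow> 'a::real_normed_vector"
  assumes "continuous_on UNIV f"
  obtains M where "M \<ge> 0" "\<And>x. x \<in> {a..b} \<Longrightarrow> norm (f x) \<le> M"
proof -
  have "bounded (f ` {a..b})"
    by (intro compact_imp_bounded compact_continuous_image continuous_on_subset[OF assms]) auto
  then obtain M where "M > 0" "\<And>x. x \<in> {a..b} \<Longrightarrow> norm (f x) \<le> M"
    unfolding bounded_pos by auto
  then show ?thesis using that[of M] by auto
qed

text \<open>Substituting x = c + y/(n+1) fixes the kernel and moves the dilation into f. On the
  support of \<rho> the arguments stay in [c, c+1], where f is bounded, so dominated convergence
  applies.\<close>

lemma mollifier_tendsto:
  fixes f :: "real \<Rightarrow> complex"
  assumes f: "continuous_on UNIV f" and \<rho>: "continuous_on UNIV \<rho>" "\<And>x. 0 \<le> \<rho> x"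
    "\<And>x. x \<notin> {0..1} \<Longrightarrow> \<rho> x = 0" "(LINT x|lborel. \<rho> x) = 1"
  shows "(\<lambda>n. LINT x|lborel. (real (Suc n) * \<rho> (real (Suc n) * (x - c))) *\<^sub>R f x) \<longlonglongrightarrow> f c"
proof -
  have \<rho>ind: "(\<lambda>x. indicator {0..1} x *\<^sub>R \<rho> x) = \<rho>"
    using \<rho>(3) by (auto simp: fun_eq_iff indicator_def)
  have int: "integrable lborel \<rho>"
    using borel_integrable_compact[of "{0..1}" \<rho>] continuous_on_subset[OF \<rho>(1)] \<rho>ind by auto
  have meas [measurable]: "\<rho> \<in> borel_measurable borel" "f \<in> borel_measurable borel"
    using f \<rho>(1) by (auto intro: borel_measurable_continuous_onI)
  have eq: "(LINT x|lborel. (real (Suc n) * \<rho> (real (Suc n) * (x - c))) *\<^sub>R f x)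
      = (LINT y|lborel. \<rho> y *\<^sub>R f (c + y / real (Suc n)))" for n
  proof -
    define m where "m = real (Suc n)"
    have m: "m > 0" by (simp add: m_def)
    have "(LINT x|lborel. (m * \<rho> (m * (x - c))) *\<^sub>R f x)
        = \<bar>1 / m\<bar> *\<^sub>R (LINT y|lborel. (m * \<rho> (m * ((c + 1 / m * y) - c))) *\<^sub>R f (c + 1 / m * y))"
      by (rule lborel_integral_real_affine) (use m in simp)
    also have "\<dots> = (LINT y|lborel. \<bar>1 / m\<bar> *\<^sub>R ((m * \<rho> (m * ((c + 1 / m * y) - c))) *\<^sub>R f (c + 1 / m * y)))"
      by (rule integral_scaleR_right[symmetric])
    also have "\<dots> = (LINT y|lborel. \<rho> y *\<^sub>R f (c + y / m))"
      using m by (intro Bochner_Integration.integral_cong) auto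
    finally show ?thesis unfolding m_def .
  qed
  obtain M where M: "M \<ge> 0" "\<And>x. x \<in> {c..c+1} \<Longrightarrow> cmod (f x) \<le> M"
    using continuous_bounded_Icc[OF f] by blast
  have "(\<lambda>n. LINT y|lborel. \<rho> y *\<^sub>R f (c + y / real (Suc n))) \<longlonglongrightarrow> (LINT y|lborel. \<rho> y *\<^sub>R f c)"
  proof (rule integral_dominated_convergence[where w = "\<lambda>y. \<rho> y * M"])
    show "integrable lborel (\<lambda>y. \<rho> y * M)" using int by auto
    show "AE y in lborel. (\<lambda>n. \<rho> y *\<^sub>R f (c + y / real (Suc n))) \<longlonglongrightarrow> \<rho> y *\<^sub>R f c"
    proof (rule AE_I2)
      fix y
      have "(\<lambda>n. y * inverse (real (Suc n))) \<longlonglongrightarrow> y * 0"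
        by (intro tendsto_intros LIMSEQ_inverse_real_of_nat)
      then have "(\<lambda>n. c + y / real (Suc n)) \<longlonglongrightarrow> c + 0"
        by (intro tendsto_intros) (simp add: field_simps)
      moreover have "isCont f c" using f by (simp add: continuous_on_eq_continuous_at)
      ultimately have "(\<lambda>n. f (c + y / real (Suc n))) \<longlonglongrightarrow> f c"
        using isCont_tendsto_compose[of c f] by (simp del: of_nat_Suc)
      then show "(\<lambda>n. \<rho> y *\<^sub>R f (c + y / real (Suc n))) \<longlonglongrightarrow> \<rho> y *\<^sub>R f c"
        by (intro tendsto_intros)
    qed
    show "AE y in lborel. norm (\<rho> y *\<^sub>R f (c + y / real (Suc n))) \<le> \<rho> y * M" for n
    proof (rule AE_I2)
      fix y
      show "norm (\<rho> y *\<^sub>R f (c + y / real (Suc n))) \<le> \<rho> y * M"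
      proof (cases "y \<in> {0..1}")
        case True
        then have "c + y / real (Suc n) \<in> {c..c+1}" by (auto simp: field_simps)
        from M(2)[OF this] \<rho>(2)[of y] show ?thesis by (simp add: mult_left_mono del: of_nat_Suc)
      qed (use \<rho>(3) in auto)
    qed
  qed measurable
  also have "(LINT y|lborel. \<rho> y *\<^sub>R f c) = f c"
    using int \<rho>(4) by (subst integral_scaleR_left) auto
  finally show ?thesis unfolding eq .
qed

text \<open>The test function is a smoothed indicator of the interval. Its derivative is the
  difference of two kernels concentrating at a and at b, which recovers the values f a and f
  b.\<close>

lemma weak_derivative_FTC:
  assumes f: "continuous_on UNIV f" and g: "is_weak_derivative_L2 f g" and ab: "a \<le> b"
  shows "(LINT x|lborel. indicator {a..b} x *\<^sub>R g x) = f b - f a"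
proof -
  obtain S \<rho> :: "real \<Rightarrow> real"
    where S12: "infinitely_differentiable S" "\<And>x. (S has_real_derivative \<rho> x) (at x)"
      and \<rho>: "\<And>x. 0 \<le> \<rho> x" "\<And>x. x \<notin> {0..1} \<Longrightarrow> \<rho> x = 0" "continuous_on UNIV \<rho>"
      and S36: "\<And>x. x \<le> 0 \<Longrightarrow> S x = 0" "\<And>x. x \<ge> 1 \<Longrightarrow> S x = 1" "\<And>x. 0 \<le> S x" "\<And>x. S x \<le> 1"
    by (rule smooth_step_exists) blast
  note S = S12 S36
  have contS: "continuous_on A S" for A using infinitely_differentiable_cont[OF S(1)] .
  have \<rho>ind: "(\<lambda>x. indicator {0..1} x *\<^sub>R \<rho> x) = \<rho>"
    using \<rho>(2) by (auto simp: fun_eq_iff indicator_def)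
  have int: "integrable lborel \<rho>"
    using borel_integrable_compact[of "{0..1}" \<rho>] continuous_on_subset[OF \<rho>(3)] \<rho>ind by auto
  have \<rho>1: "(LINT x|lborel. \<rho> x) = 1"
    using FTC_lborel[of "{}" 0 1 S \<rho>] S(2) contS S(3)[of 0] S(4)[of 1] int
    unfolding \<rho>ind has_real_derivative_iff_has_vector_derivative by auto
  have sq: "square_integrable g" using g by (simp add: is_weak_derivative_L2_def)
  have [measurable]: "g \<in> borel_measurable borel" "S \<in> borel_measurable borel"
      "\<rho> \<in> borel_measurable borel" "f \<in> borel_measurable borel"
    using sq contS \<rho>(3) f by (auto simp: square_integrable_def intro: borel_measurable_continuous_onI)
  define m where "m n = real (Suc n)" for n
  have m: "m n \<ge> 1" "m n > 0" for n by (auto simp: m_def)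
  \<comment> \<open>Two steps of width \<open>1 / m n\<close>, rising to the right of a and falling
    to the right of b. Since \<open>m n\<close> is at least 1, all supports lie in [a, b+1], which
    provides a dominating function.\<close>
  define \<eta> where "\<eta> n x = S (m n * (x - a)) - S (m n * (x - b))" for n x
  define \<eta>' where "\<eta>' n x = m n * \<rho> (m n * (x - a)) - m n * \<rho> (m n * (x - b))" for n x
  have d\<eta>: "(\<eta> n has_real_derivative \<eta>' n x) (at x)" for n x
  proof -
    have "((\<lambda>x. S (m n * (x - c))) has_real_derivative \<rho> (m n * (x - c)) * m n) (at x)" for c
      by (rule DERIV_chain2[OF S(2)]) (auto intro!: derivative_eq_intros)
    then show ?thesis
      unfolding \<eta>_def \<eta>'_def by (auto intro!: derivative_eq_intros)
  qed
  have supp: "\<eta> n x = 0" if "x \<notin> {a..b+1}" for n x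
  proof (cases "x < a")
    case True
    then show ?thesis using ab m(2)[of n] by (simp add: \<eta>_def S(3) mult_nonneg_nonpos)
  next
    case False
    then have x: "x - b \<ge> 1" "x - a \<ge> 1" using that ab by auto
    have "1 \<le> m n * (x - b)" "1 \<le> m n * (x - a)"
      using mult_mono[OF m(1)[of n] x(1)] mult_mono[OF m(1)[of n] x(2)] m(2)[of n] by auto
    then show ?thesis by (simp add: \<eta>_def S(4))
  qed
  have "infinitely_differentiable (\<eta> n)" for n
  proof -
    have *: "infinitely_differentiable (\<lambda>x. S (m n * x + - m n * c))" for c
      by (intro infinitely_differentiable_compose_affine S)
    have "infinitely_differentiable (\<lambda>x. S (m n * x + - m n * a) + - S (m n * x + - m n * b))"
      by (rule infinitely_differentiable_add[OF * infinitely_differentiable_compose_linear[OF *]])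
         (intro bounded_linear_minus bounded_linear_ident)
    moreover have "\<eta> n = (\<lambda>x. S (m n * x + - m n * a) + - S (m n * x + - m n * b))"
      by (simp add: fun_eq_iff \<eta>_def algebra_simps)
    ultimately show ?thesis by simp
  qed
  moreover have "compact (closure {x. \<eta> n x \<noteq> 0})" for n
  proof -
    have "{x. \<eta> n x \<noteq> 0} \<subseteq> {a..b+1}" using supp by blast
    then have "bounded {x. \<eta> n x \<noteq> 0}" by (rule bounded_subset[rotated]) auto
    then show ?thesis by simp
  qed
  ultimately have test: "\<eta> n \<in> test_functions" for n by (auto simp: test_functions_def)
  have eq: "(LINT x|lborel. \<eta>' n x *\<^sub>R f x) = - (LINT x|lborel. \<eta> n x *\<^sub>R g x)" for n
  proof -
    have "deriv (\<eta> n) = \<eta>' n" using d\<eta> by (auto intro: DERIV_imp_deriv)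
    moreover have "(LINT x|lborel. deriv (\<eta> n) x *\<^sub>R f x) = - (LINT x|lborel. \<eta> n x *\<^sub>R g x)"
      using g test unfolding is_weak_derivative_L2_def by blast
    ultimately show ?thesis by simp
  qed
  have int\<rho>f: "integrable lborel (\<lambda>x. (m n * \<rho> (m n * (x - c))) *\<^sub>R f x)" for n c
  proof -
    have eq: "(\<lambda>x. (m n * \<rho> (m n * (x - c))) *\<^sub>R f x)
        = (\<lambda>x. indicator {c..c+1} x *\<^sub>R ((m n * \<rho> (m n * (x - c))) *\<^sub>R f x))"
    proof
      fix x
      have "\<rho> (m n * (x - c)) = 0" if "x \<notin> {c..c+1}"
      proof (cases "x < c")
        case True
        then have "m n * (x - c) < 0" using m(2) by (simp add: mult_pos_neg)
        then show ?thesis by (intro \<rho>(2)) auto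
      next
        case False
        then have "1 < x - c" using that by auto
        then have "1 < m n * (x - c)" using m(1)[of n] m(2)[of n]
          by (smt (verit) mult_le_cancel_right1)
        then show ?thesis by (intro \<rho>(2)) auto
      qed
      then show "(m n * \<rho> (m n * (x - c))) *\<^sub>R f x
          = indicator {c..c+1} x *\<^sub>R ((m n * \<rho> (m n * (x - c))) *\<^sub>R f x)"
        by (auto simp: indicator_def)
    qed
    show ?thesis
      by (subst eq) (intro borel_integrable_compact continuous_intros continuous_on_compose2[OF \<rho>(3)]
          continuous_on_subset[OF f]; simp)
  qed
  have "(\<lambda>n. (LINT x|lborel. (m n * \<rho> (m n * (x - a))) *\<^sub>R f x)
      - (LINT x|lborel. (m n * \<rho> (m n * (x - b))) *\<^sub>R f x)) \<longlonglongrightarrow> f a - f b"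
    unfolding m_def by (intro tendsto_diff mollifier_tendsto f \<rho> \<rho>1)
  then have lim1: "(\<lambda>n. LINT x|lborel. \<eta>' n x *\<^sub>R f x) \<longlonglongrightarrow> f a - f b"
    using int\<rho>f by (simp add: \<eta>'_def scaleR_diff_left)
  have \<eta>bound: "\<bar>\<eta> n x\<bar> \<le> indicator {a..b+1} x" for n x
    using supp[of x n] S(5,6)[of "m n * (x - a)"] S(5,6)[of "m n * (x - b)"]
    by (cases "x \<in> {a..b+1}") (auto simp: \<eta>_def)
  \<comment> \<open>Because S 0 = 0 the limit is the half-open interval; the null set {a} is
    restored at the end.\<close>
  have \<eta>lim: "(\<lambda>n. \<eta> n x) \<longlonglongrightarrow> indicator {a<..b} x" for x
  proof -
    have step: "(\<lambda>n. S (m n * (x - c))) \<longlonglongrightarrow> indicator {c<..} x" for c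
    proof (cases "x \<le> c")
      case True
      then show ?thesis using m(2) by (auto simp: S(3) mult_nonneg_nonpos less_imp_le)
    next
      case False
      obtain N :: nat where N: "1 / (x - c) \<le> real N" using real_arch_simple by blast
      have "S (m n * (x - c)) = 1" if "n \<ge> N" for n
      proof -
        have "1 / (x - c) \<le> m n" using N that by (simp add: m_def)
        then show ?thesis using False by (intro S(4)) (simp add: field_simps)
      qed
      then have "eventually (\<lambda>n. S (m n * (x - c)) = 1) sequentially"
        by (auto simp: eventually_sequentially)
      then show ?thesis using False by (auto intro: tendsto_eventually)
    qed
    have "(\<lambda>n. \<eta> n x) \<longlonglongrightarrow> indicator {a<..} x - indicator {b<..} x"
      unfolding \<eta>_def by (intro tendsto_diff step)
    also have "indicator {a<..} x - indicator {b<..} x = (indicator {a<..b} x :: real)"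
      using ab by (auto simp: indicator_def)
    finally show ?thesis .
  qed
  have lim2: "(\<lambda>n. LINT x|lborel. \<eta> n x *\<^sub>R g x) \<longlonglongrightarrow> (LINT x|lborel. indicator {a<..b} x *\<^sub>R g x)"
  proof (rule integral_dominated_convergence[where w = "\<lambda>x. norm (indicator {a..b+1} x *\<^sub>R g x)"])
    show "integrable lborel (\<lambda>x. norm (indicator {a..b+1} x *\<^sub>R g x))"
      by (intro integrable_norm square_integrable_restrict_integrable sq)
    show "AE x in lborel. (\<lambda>n. \<eta> n x *\<^sub>R g x) \<longlonglongrightarrow> indicator {a<..b} x *\<^sub>R g x"
      by (intro AE_I2 tendsto_intros \<eta>lim)
    show "AE x in lborel. norm (\<eta> n x *\<^sub>R g x) \<le> norm (indicator {a..b+1} x *\<^sub>R g x)" for n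
      using \<eta>bound by (auto intro!: AE_I2 mult_right_mono simp: abs_le_iff)
    show "(\<lambda>x. \<eta> n x *\<^sub>R g x) \<in> borel_measurable lborel" for n
      unfolding \<eta>_def by measurable
  qed measurable
  have "(\<lambda>n. - (LINT x|lborel. \<eta>' n x *\<^sub>R f x)) \<longlonglongrightarrow> - (f a - f b)"
    by (intro tendsto_minus lim1)
  then have "(\<lambda>n. LINT x|lborel. \<eta> n x *\<^sub>R g x) \<longlonglongrightarrow> f b - f a"
    by (simp add: eq)
  then have "(LINT x|lborel. indicator {a<..b} x *\<^sub>R g x) = f b - f a"
    using lim2 LIMSEQ_unique by blast
  moreover have "(LINT x|lborel. indicator {a<..b} x *\<^sub>R g x) = (LINT x|lborel. indicator {a..b} x *\<^sub>R g x)"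
    by (rule integral_cong_AE)
       (use AE_lborel_singleton[of a] in \<open>auto simp: indicator_def elim!: eventually_mono\<close>)
  ultimately show ?thesis by simp
qed

section \<open>Uniqueness of weak derivatives\<close>

text \<open>The positive and the negative part of h, cut off to [-N, N] because h is only locally
  integrable, are densities of finite measures that agree on all half-lines. The measures coincide,
  hence so do the densities almost everywhere.\<close>

lemma AE_zero_if_interval_integrals_zero:
  fixes h :: "real \<Rightarrow> real"
  assumes [measurable]: "h \<in> borel_measurable borel"
    and int: "\<And>a b. integrable lborel (\<lambda>x. indicator {a..b} x * h x)"
    and zero: "\<And>a b. a \<le> b \<Longrightarrow> (LINT x|lborel. indicator {a..b} x * h x) = 0"
  shows "AE x in lborel. h x = 0"
proof -
  have "AE x in lborel. indicator {- real N..real N} x * h x = 0" for N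
  proof -
    define k where "k x = indicator {- real N..real N} x * h x" for x
    have [measurable]: "k \<in> borel_measurable borel" unfolding k_def by measurable
    have k: "integrable lborel k" using int[of "- real N" "real N"] by (simp add: k_def[abs_def])
    define p where "p x = max 0 (k x)" for x
    define q where "q x = max 0 (- k x)" for x
    have pq: "integrable lborel p" "integrable lborel q" "\<And>x. p x \<ge> 0" "\<And>x. q x \<ge> 0" "\<And>x. p x - q x = k x"
      using k by (auto simp: p_def[abs_def] q_def[abs_def])
    have [measurable]: "p \<in> borel_measurable borel" "q \<in> borel_measurable borel"
      unfolding p_def[abs_def] q_def[abs_def] by measurable
    have ind: "integrable lborel (\<lambda>x. indicator {c<..} x * g x)" if "integrable lborel g" for c and g :: "real \<Rightarrow> real"
      using integrable_mult_indicator[OF _ that, of "{c<..}"] by simp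
    have em: "emeasure (density lborel (\<lambda>x. ennreal (g x))) {c<..} = ennreal (LINT x|lborel. indicator {c<..} x * g x)"
      if "integrable lborel g" "\<And>x. g x \<ge> 0" "g \<in> borel_measurable borel" for g :: "real \<Rightarrow> real" and c
    proof -
      have "emeasure (density lborel (\<lambda>x. ennreal (g x))) {c<..}
          = (\<integral>\<^sup>+ x. ennreal (indicator {c<..} x * g x) \<partial>lborel)"
        using that by (auto simp: emeasure_density indicator_def intro!: nn_integral_cong)
      also have "\<dots> = ennreal (LINT x|lborel. indicator {c<..} x * g x)"
        using that ind[OF that(1)] by (intro nn_integral_eq_integral) auto
      finally show ?thesis .
    qed
    have "density lborel (\<lambda>x. ennreal (p x)) = density lborel (\<lambda>x. ennreal (q x))"
    proof (rule measure_eqI_lessThan)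
      fix c
      show "emeasure (density lborel (\<lambda>x. ennreal (p x))) {c<..} < \<infinity>"
        by (simp add: em pq)
      have "(LINT x|lborel. indicator {c<..} x * p x) - (LINT x|lborel. indicator {c<..} x * q x)
          = (LINT x|lborel. indicator {c<..} x * k x)"
        using pq ind by (subst Bochner_Integration.integral_diff[symmetric]) (auto simp: algebra_simps simp flip: pq(5))
      also have "\<dots> = (LINT x|lborel. indicator {max c (- real N)..real N} x * h x)"
      proof (rule integral_cong_AE)
        show "AE x in lborel. indicator {c<..} x * k x = indicator {max c (- real N)..real N} x * h x"
          using AE_lborel_singleton[of c] by (auto simp: k_def indicator_def elim!: eventually_mono)
      qed measurable
      also have "\<dots> = 0"
        using zero[of "max c (- real N)" "real N"] by (cases "max c (- real N) \<le> real N") auto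
      finally show "emeasure (density lborel (\<lambda>x. ennreal (p x))) {c<..}
          = emeasure (density lborel (\<lambda>x. ennreal (q x))) {c<..}"
        by (simp add: em pq)
    qed auto
    then have "AE x in lborel. ennreal (p x) = ennreal (q x)"
      by (intro sigma_finite_measure.density_unique[OF lborel.sigma_finite_measure_axioms]) auto
    then show ?thesis
      by (elim eventually_mono) (use pq in \<open>auto simp: k_def[symmetric] simp flip: pq(5)\<close>)
  qed
  then have "AE x in lborel. \<forall>N. indicator {- real N..real N} x * h x = 0"
    unfolding AE_all_countable by blast
  then show ?thesis
  proof (elim eventually_mono)
    fix x assume *: "\<forall>N. indicator {- real N..real N} x * h x = 0"
    obtain N :: nat where "\<bar>x\<bar> \<le> real N" using real_arch_simple by blast
    then have "x \<in> {- real N..real N}" by auto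
    then show "h x = 0" using *[rule_format, of N] by simp
  qed
qed

lemma AE_eq_if_interval_integrals_eq:
  fixes g g' :: "real \<Rightarrow> complex"
  assumes [measurable]: "g \<in> borel_measurable borel" "g' \<in> borel_measurable borel"
    and int: "\<And>a b. integrable lborel (\<lambda>x. indicator {a..b} x *\<^sub>R g x)"
      "\<And>a b. integrable lborel (\<lambda>x. indicator {a..b} x *\<^sub>R g' x)"
    and eq: "\<And>a b. a \<le> b \<Longrightarrow>
      (LINT x|lborel. indicator {a..b} x *\<^sub>R g x) = (LINT x|lborel. indicator {a..b} x *\<^sub>R g' x)"
  shows "AE x in lborel. g x = g' x"
proof -
  have int: "integrable lborel (\<lambda>x. indicator {a..b} x *\<^sub>R (g x - g' x))" for a b
    using int[of a b] by (simp add: scaleR_diff_right)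
  have zero: "(LINT x|lborel. indicator {a..b} x *\<^sub>R (g x - g' x)) = 0" if "a \<le> b" for a b
    using assms(3,4)[of a b] eq[OF that] by (simp add: scaleR_diff_right)
  have "AE x in lborel. Re (g x - g' x) = 0"
    using integrable_Re[OF int] integral_Re[OF int] zero
    by (intro AE_zero_if_interval_integrals_zero) (auto simp del: minus_complex.simps)
  moreover have "AE x in lborel. Im (g x - g' x) = 0"
    using integrable_Im[OF int] integral_Im[OF int] zero
    by (intro AE_zero_if_interval_integrals_zero) (auto simp del: minus_complex.simps)
  ultimately show ?thesis
    by eventually_elim (auto simp: complex_eq_iff)
qed

text \<open>Both integrate to f b - f a over every interval. This frees later computations from the
  choice made in \<open>weak_derivative\<close>.\<close>

lemma weak_derivative_unique_AE:
  assumes f: "continuous_on UNIV f" and g: "is_weak_derivative_L2 f g" "is_weak_derivative_L2 f g'"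
  shows "AE x in lborel. g x = g' x"
proof (rule AE_eq_if_interval_integrals_eq)
  have sq: "square_integrable g" "square_integrable g'" using g by (auto simp: is_weak_derivative_L2_def)
  then show "g \<in> borel_measurable borel" "g' \<in> borel_measurable borel"
    by (auto simp: square_integrable_def)
  show "integrable lborel (\<lambda>x. indicator {a..b} x *\<^sub>R g x)"
    "integrable lborel (\<lambda>x. indicator {a..b} x *\<^sub>R g' x)" for a b
    by (intro square_integrable_restrict_integrable sq)+
qed (use weak_derivative_FTC[OF f g(1)] weak_derivative_FTC[OF f g(2)] in simp)

text \<open>An elementary Sobolev embedding. On [y, y+1] the function |f|^2 must drop below F + 1
  somewhere, since its integral is at most F; from that point to y, f changes by at most the
  integral of |g|.\<close>

lemma H1_bounded:
  assumes f: "continuous_on UNIV f" "square_integrable f" and g: "is_weak_derivative_L2 f g"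
  obtains M where "M > 0" "\<And>x. cmod (f x) \<le> M"
proof -
  have sq: "square_integrable g" using g by (auto simp: is_weak_derivative_L2_def)
  define F where "F = (LINT x|lborel. (cmod (f x))\<^sup>2)"
  define G where "G = (LINT x|lborel. (cmod (g x))\<^sup>2)"
  have FG: "F \<ge> 0" "G \<ge> 0" by (auto simp: F_def G_def)
  have le: "t \<le> 1 + t\<^sup>2" for t :: real
    using zero_le_power2[of "t - 1 / 2"] by (simp add: power2_eq_square field_simps)
  \<comment> \<open>By t <= 1 + t^2, \<open>2 + F\<close> bounds |f| at the point where |f|^2 < F +
    1, and \<open>1 + G\<close> bounds the change over a unit interval.\<close>
  have "cmod (f y) \<le> (2 + F) + (1 + G)" for y
  proof -
    have "\<exists>x\<in>{y..y+1}. (cmod (f x))\<^sup>2 < F + 1"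
    proof (rule ccontr)
      assume "\<not> ?thesis"
      then have *: "F + 1 \<le> (cmod (f x))\<^sup>2" if "x \<in> {y..y+1}" for x using that by force
      have "F + 1 = (LINT x|lborel. indicator {y..y+1} x * (F + 1))"
        by simp
      also have "\<dots> \<le> F"
        unfolding F_def
      proof (rule integral_mono)
        show "integrable lborel (\<lambda>x. (cmod (f x))\<^sup>2)" using f by (simp add: square_integrable_def)
        show "indicator {y..y+1} x * ((LINT x|lborel. (cmod (f x))\<^sup>2) + 1) \<le> (cmod (f x))\<^sup>2" for x
          using *[of x] by (cases "x \<in> {y..y+1}") (auto simp: F_def)
      qed simp
      finally show False by simp
    qed
    then obtain x where x: "x \<in> {y..y+1}" "(cmod (f x))\<^sup>2 < F + 1" by auto
    have "cmod (f x - f y) \<le> (LINT t|lborel. norm (indicator {y..x} t *\<^sub>R g t))"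
      using weak_derivative_FTC[OF f(1) g, of y x] x(1)
        integral_norm_bound[of lborel "\<lambda>t. indicator {y..x} t *\<^sub>R g t"] by simp
    also have "\<dots> \<le> (LINT t|lborel. indicator {y..y+1} t + (cmod (g t))\<^sup>2)"
    proof (rule integral_mono)
      show "integrable lborel (\<lambda>t. norm (indicator {y..x} t *\<^sub>R g t))"
        by (intro integrable_norm square_integrable_restrict_integrable sq)
      show "integrable lborel (\<lambda>t. indicator {y..y+1} t + (cmod (g t))\<^sup>2)"
        using sq by (auto simp: square_integrable_def)
      show "norm (indicator {y..x} t *\<^sub>R g t) \<le> indicator {y..y+1} t + (cmod (g t))\<^sup>2" for t
        using le[of "cmod (g t)"] x by (auto simp: indicator_def)
    qed
    also have "\<dots> = 1 + G"
      using sq by (simp add: square_integrable_def G_def)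
    finally have "cmod (f x - f y) \<le> 1 + G" .
    moreover have "cmod (f x) \<le> 2 + F" using le[of "cmod (f x)"] x by simp
    ultimately show ?thesis
      using norm_triangle_ineq4[of "f x" "f x - f y"] by simp
  qed
  then show ?thesis using that[of "(2 + F) + (1 + G)"] FG by auto
qed

lemma test_functionE:
  assumes "\<psi> \<in> test_functions"
  obtains R K where "R > 0" "K \<ge> 0" "\<psi> R = 0" "\<psi> (- R) = 0"
    "\<And>x. \<bar>\<psi> x\<bar> \<le> K * indicator {- R..R} x" "\<And>x. \<bar>deriv \<psi> x\<bar> \<le> K * indicator {- R..R} x"
    "continuous_on UNIV \<psi>" "continuous_on UNIV (deriv \<psi>)" "\<And>x. (\<psi> has_real_derivative deriv \<psi> x) (at x)"
proof -
  have smooth: "infinitely_differentiable \<psi>" and comp: "compact (closure {x. \<psi> x \<noteq> 0})"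
    using assms by (auto simp: test_functions_def)
  obtain \<psi>' where \<psi>': "infinitely_differentiable \<psi>'" "\<And>x. (\<psi> has_real_derivative \<psi>' x) (at x)"
    using infinitely_differentiableE[OF smooth] unfolding has_real_derivative_iff_has_vector_derivative by blast
  have deriv: "deriv \<psi> = \<psi>'" using \<psi>'(2) by (auto intro: DERIV_imp_deriv)
  have cont: "continuous_on UNIV \<psi>" "continuous_on UNIV \<psi>'"
    using smooth \<psi>'(1) by (auto intro: infinitely_differentiable_cont)
  obtain R0 where R0: "R0 > 0" "\<And>x. x \<in> closure {x. \<psi> x \<noteq> 0} \<Longrightarrow> \<bar>x\<bar> \<le> R0"
    using compact_imp_bounded[OF comp] unfolding bounded_pos by auto
  \<comment> \<open>The margin 1 places -R and R outside the support, so that boundary terms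
    vanish.\<close>
  define R where "R = R0 + 1"
  have R: "R > 0" using R0(1) by (simp add: R_def)
  have z: "\<psi> x = 0" "\<psi>' x = 0" if "\<bar>x\<bar> > R0" for x
  proof -
    have *: "x \<in> - closure {x. \<psi> x \<noteq> 0}" using R0(2)[of x] that by auto
    have **: "\<psi> y = 0" if "y \<in> - closure {x. \<psi> x \<noteq> 0}" for y
      using that closure_subset[of "{x. \<psi> x \<noteq> 0}"] by auto
    then show "\<psi> x = 0" using * by blast
    have "(\<psi> has_real_derivative 0) (at x)"
      by (rule has_field_derivative_transform_within_open[OF DERIV_const[of 0] _ * **[symmetric]])
         (rule open_Compl, rule closed_closure)
    then show "\<psi>' x = 0" using \<psi>'(2) DERIV_unique by blast
  qed
  obtain K1 where K1: "K1 \<ge> 0" "\<And>x. x \<in> {- R..R} \<Longrightarrow> norm (\<psi> x) \<le> K1"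
    using continuous_bounded_Icc[OF cont(1)] by blast
  obtain K2 where K2: "K2 \<ge> 0" "\<And>x. x \<in> {- R..R} \<Longrightarrow> norm (\<psi>' x) \<le> K2"
    using continuous_bounded_Icc[OF cont(2)] by blast
  show ?thesis
  proof (rule that[of R "max K1 K2"])
    show "\<bar>\<psi> x\<bar> \<le> max K1 K2 * indicator {- R..R} x" for x
      using K1(2)[of x] z(1)[of x] by (cases "x \<in> {-R..R}") (auto simp: R_def abs_le_iff)
    show "\<bar>deriv \<psi> x\<bar> \<le> max K1 K2 * indicator {- R..R} x" for x
      using K2(2)[of x] z(2)[of x] by (cases "x \<in> {-R..R}") (auto simp: R_def abs_le_iff deriv)
    show "\<psi> R = 0" "\<psi> (- R) = 0"
      using R R0(1) by (auto intro!: z(1) simp: R_def)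
  qed (use R cont deriv \<psi>'(2) K1(1) in auto)
qed

lemma integrable_bounded_support_mult_cont:
  fixes \<phi> :: "real \<Rightarrow> real" and f :: "real \<Rightarrow> complex"
  assumes "continuous_on UNIV \<phi>" "\<And>x. \<bar>\<phi> x\<bar> \<le> K * indicator {a..b} x" "continuous_on UNIV f"
  shows "integrable lborel (\<lambda>x. \<phi> x *\<^sub>R f x)"
proof -
  have "\<phi> x = 0" if "x \<notin> {a..b}" for x using assms(2)[of x] that by simp
  then have eq: "(\<lambda>x. \<phi> x *\<^sub>R f x) = (\<lambda>x. indicator {a..b} x *\<^sub>R (\<phi> x *\<^sub>R f x))"
    by (auto simp: fun_eq_iff indicator_def)
  show ?thesis
    by (subst eq) (intro borel_integrable_compact continuous_intros continuous_on_subset[OF assms(1)]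
        continuous_on_subset[OF assms(3)]; simp)
qed

text \<open>The product of \<psi> and F vanishes at both ends of [-R, R], so its derivative has
  integral 0. This produces weak derivatives: of tents, with their kinks in \<open>S\<close>, and of
  classically differentiable functions, with \<open>S\<close> empty.\<close>

lemma test_function_integration_by_parts:
  fixes F :: "real \<Rightarrow> complex"
  assumes \<psi>: "\<psi> \<in> test_functions" and F: "continuous_on UNIV F" and S: "finite S"
    and d: "\<And>x. x \<notin> S \<Longrightarrow> (F has_vector_derivative g x) (at x)"
    and int: "integrable lborel (\<lambda>x. \<psi> x *\<^sub>R g x)"
  shows "(LINT x|lborel. deriv \<psi> x *\<^sub>R F x) = - (LINT x|lborel. \<psi> x *\<^sub>R g x)"
proof -
  obtain R K where R: "R > 0" "K \<ge> 0" "\<psi> R = 0" "\<psi> (- R) = 0"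
    and b: "\<And>x. \<bar>\<psi> x\<bar> \<le> K * indicator {- R..R} x" "\<And>x. \<bar>deriv \<psi> x\<bar> \<le> K * indicator {- R..R} x"
    and c: "continuous_on UNIV \<psi>" "continuous_on UNIV (deriv \<psi>)"
    and D: "\<And>x. (\<psi> has_real_derivative deriv \<psi> x) (at x)"
    by (rule test_functionE[OF \<psi>]) blast
  have z: "\<psi> x = 0" "deriv \<psi> x = 0" if "x \<notin> {-R..R}" for x using b[of x] that by auto
  have i1: "integrable lborel (\<lambda>x. deriv \<psi> x *\<^sub>R F x)"
    by (rule integrable_bounded_support_mult_cont[OF c(2) b(2) F])
  have ind: "(\<lambda>x. indicator {-R..R} x *\<^sub>R (\<psi> x *\<^sub>R g x + deriv \<psi> x *\<^sub>R F x))
      = (\<lambda>x. \<psi> x *\<^sub>R g x + deriv \<psi> x *\<^sub>R F x)"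
    using z by (auto simp: fun_eq_iff indicator_def)
  have "(LINT x|lborel. indicator {-R..R} x *\<^sub>R (\<psi> x *\<^sub>R g x + deriv \<psi> x *\<^sub>R F x))
      = \<psi> R *\<^sub>R F R - \<psi> (- R) *\<^sub>R F (- R)"
  proof (rule FTC_lborel[OF S])
    show "((\<lambda>x. \<psi> x *\<^sub>R F x) has_vector_derivative \<psi> x *\<^sub>R g x + deriv \<psi> x *\<^sub>R F x) (at x)"
      if "x \<in> {-R..R} - S" for x
      by (intro has_vector_derivative_scaleR D d) (use that in auto)
    show "continuous_on {-R..R} (\<lambda>x. \<psi> x *\<^sub>R F x)"
      by (intro continuous_intros continuous_on_subset[OF c(1)] continuous_on_subset[OF F]) auto
    show "integrable lborel (\<lambda>x. indicator {-R..R} x *\<^sub>R (\<psi> x *\<^sub>R g x + deriv \<psi> x *\<^sub>R F x))"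
      unfolding ind using int i1 by simp
  qed (use R in auto)
  then have "(LINT x|lborel. \<psi> x *\<^sub>R g x + deriv \<psi> x *\<^sub>R F x) = 0"
    unfolding ind using R by simp
  then show ?thesis
    using int i1 by (simp add: add_eq_0_iff)
qed

lemma test_function_mult_square_integrable:
  assumes "\<psi> \<in> test_functions" "square_integrable g"
  shows "integrable lborel (\<lambda>x. \<psi> x *\<^sub>R g x)"
proof -
  obtain R K where R: "R > 0" "K \<ge> 0" "\<psi> R = 0" "\<psi> (- R) = 0"
    and b: "\<And>x. \<bar>\<psi> x\<bar> \<le> K * indicator {- R..R} x" "\<And>x. \<bar>deriv \<psi> x\<bar> \<le> K * indicator {- R..R} x"
    and c: "continuous_on UNIV \<psi>" "continuous_on UNIV (deriv \<psi>)"
    and D: "\<And>x. (\<psi> has_real_derivative deriv \<psi> x) (at x)"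
    by (rule test_functionE[OF assms(1)]) blast
  show ?thesis
    by (rule square_integrable_mult_bounded_support[OF assms(2) _ b(1)])
       (use c(1) in \<open>auto intro: borel_measurable_continuous_onI\<close>)
qed

lemma deriv_test_function_mult_cont:
  fixes f :: "real \<Rightarrow> complex"
  assumes "\<psi> \<in> test_functions" "continuous_on UNIV f"
  shows "integrable lborel (\<lambda>x. deriv \<psi> x *\<^sub>R f x)"
proof -
  obtain R K where R: "R > 0" "K \<ge> 0" "\<psi> R = 0" "\<psi> (- R) = 0"
    and b: "\<And>x. \<bar>\<psi> x\<bar> \<le> K * indicator {- R..R} x" "\<And>x. \<bar>deriv \<psi> x\<bar> \<le> K * indicator {- R..R} x"
    and c: "continuous_on UNIV \<psi>" "continuous_on UNIV (deriv \<psi>)"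
    and D: "\<And>x. (\<psi> has_real_derivative deriv \<psi> x) (at x)"
    by (rule test_functionE[OF assms(1)]) blast
  show ?thesis
    by (rule integrable_bounded_support_mult_cont[OF c(2) b(2) assms(2)])
qed

lemma is_weak_derivative_L2_if_deriv:
  fixes F :: "real \<Rightarrow> complex"
  assumes "continuous_on UNIV F" "finite S" "\<And>x. x \<notin> S \<Longrightarrow> (F has_vector_derivative g x) (at x)"
    and "square_integrable g"
  shows "is_weak_derivative_L2 F g"
  unfolding is_weak_derivative_L2_def
  using test_function_integration_by_parts[OF _ assms(1-3)] test_function_mult_square_integrable assms(4)
  by blast

lemma square_integrable_mult_const:
  assumes "square_integrable f"
  shows "square_integrable (\<lambda>x. c * f x)"
  using assms by (auto simp: square_integrable_def norm_mult power_mult_distrib)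

lemma square_integrable_add:
  assumes "square_integrable f" "square_integrable g"
  shows "square_integrable (\<lambda>x. f x + g x)"
proof -
  have [measurable]: "f \<in> borel_measurable borel" "g \<in> borel_measurable borel"
    using assms by (auto simp: square_integrable_def)
  have "integrable lborel (\<lambda>x. (cmod (f x + g x))\<^sup>2)"
  proof (rule Bochner_Integration.integrable_bound)
    show "integrable lborel (\<lambda>x. 2 * (cmod (f x))\<^sup>2 + 2 * (cmod (g x))\<^sup>2)"
      using assms by (auto simp: square_integrable_def)
    show "AE x in lborel. norm ((cmod (f x + g x))\<^sup>2) \<le> norm (2 * (cmod (f x))\<^sup>2 + 2 * (cmod (g x))\<^sup>2)"
    proof (rule AE_I2)
      fix x
      have "(cmod (f x + g x))\<^sup>2 \<le> (cmod (f x) + cmod (g x))\<^sup>2"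
        by (intro power_mono norm_triangle_ineq) auto
      also have "\<dots> \<le> 2 * (cmod (f x))\<^sup>2 + 2 * (cmod (g x))\<^sup>2"
        using zero_le_power2[of "cmod (f x) - cmod (g x)"] by (simp add: power2_eq_square algebra_simps)
      finally show "norm ((cmod (f x + g x))\<^sup>2) \<le> norm (2 * (cmod (f x))\<^sup>2 + 2 * (cmod (g x))\<^sup>2)"
        by simp
    qed
  qed measurable
  then show ?thesis by (auto simp: square_integrable_def)
qed

lemma is_weak_derivative_L2_mult_const:
  assumes "is_weak_derivative_L2 f g"
  shows "is_weak_derivative_L2 (\<lambda>x. c * f x) (\<lambda>x. c * g x)"
proof -
  have "(LINT x|lborel. \<psi> x *\<^sub>R (c * h x)) = c * (LINT x|lborel. \<psi> x *\<^sub>R h x)"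
    for \<psi> and h :: "real \<Rightarrow> complex"
    by (subst integral_mult_right_zero[symmetric]) simp
  then show ?thesis
    using assms square_integrable_mult_const by (simp add: is_weak_derivative_L2_def)
qed

lemma is_weak_derivative_L2_add:
  assumes "is_weak_derivative_L2 f g" "is_weak_derivative_L2 f' g'"
    and "continuous_on UNIV f" "continuous_on UNIV f'"
  shows "is_weak_derivative_L2 (\<lambda>x. f x + f' x) (\<lambda>x. g x + g' x)"
  using assms square_integrable_add
  by (simp add: is_weak_derivative_L2_def scaleR_add_right test_function_mult_square_integrable
      deriv_test_function_mult_cont)

lemma H1I:
  assumes "continuous_on UNIV f" "square_integrable f" "is_weak_derivative_L2 f g"
  shows "f \<in> H1"
  using assms by (auto simp: H1_def)

lemma H1D:
  assumes "f \<in> H1"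
  shows "continuous_on UNIV f" "square_integrable f" "is_weak_derivative_L2 f (weak_derivative f)"
  using assms someI_ex[of "is_weak_derivative_L2 f"] by (simp_all add: H1_def weak_derivative_def)

text \<open>Lets the Dirichlet integral be computed with whichever weak derivative is at
  hand.\<close>

lemma weak_derivative_energy_eq:
  assumes "f \<in> H1" "is_weak_derivative_L2 f g"
  shows "(LINT x|lborel. (cmod (weak_derivative f x))\<^sup>2) = (LINT x|lborel. (cmod (g x))\<^sup>2)"
proof (rule integral_cong_AE)
  show "AE x in lborel. (cmod (weak_derivative f x))\<^sup>2 = (cmod (g x))\<^sup>2"
    using weak_derivative_unique_AE[OF H1D(1,3) assms(2)] assms(1) by (auto elim: eventually_mono)
qed (use assms(2) H1D(3)[OF assms(1)] in \<open>auto simp: is_weak_derivative_L2_def square_integrable_def\<close>)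

section \<open>The Euler--Lagrange equation\<close>

text \<open>Convexity of t^q, obtained from Young's inequality for t and s^(q-1) with the conjugate
  exponents q and q/(q-1).\<close>

lemma powr_ge_tangent:
  fixes s t q :: real
  assumes "2 \<le> q" "0 \<le> s" "0 \<le> t"
  shows "s powr q + q * s powr (q - 1) * (t - s) \<le> t powr q"
proof (cases "s = 0")
  case False
  have "t * s powr (q - 1) \<le> t powr q / q + (s powr (q - 1)) powr (q / (q - 1)) / (q / (q - 1))"
    using assms by (intro Youngs_inequality) (auto simp: field_simps)
  also have "(s powr (q - 1)) powr (q / (q - 1)) = s powr q"
    using assms by (simp add: powr_powr)
  finally have "q * (t * s powr (q - 1)) \<le> t powr q + (q - 1) * s powr q"
    using assms by (simp add: field_simps)
  moreover have "s powr q = s powr (q - 1) * s"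
    using powr_add[of s "q - 1" 1] assms by simp
  ultimately show ?thesis by (simp add: algebra_simps)
qed (use assms in auto)

text \<open>The gradient of |z|^q is q |z|^(q-2) z. From Re (z cnj (z + w)) <= |z| |z + w| follows
  Re (z cnj w) <= |z| (|z + w| - |z|), which reduces the claim to the radial tangent
  inequality.\<close>

lemma cmod_powr_ge_tangent:
  assumes "2 \<le> q"
  shows "cmod z powr q + q * cmod z powr (q - 2) * Re (z * cnj w) \<le> cmod (z + w) powr q"
proof (cases "z = 0")
  case False
  define s where "s = cmod z"
  have s: "s > 0" using False by (simp add: s_def)
  have "Re (z * cnj (z + w)) \<le> cmod (z * cnj (z + w))" by (rule complex_Re_le_cmod)
  moreover have "Re (z * cnj (z + w)) = s\<^sup>2 + Re (z * cnj w)"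
    unfolding s_def cmod_power2 by (simp add: power2_eq_square algebra_simps)
  ultimately have "Re (z * cnj w) \<le> s * (cmod (z + w) - s)"
    unfolding norm_mult complex_mod_cnj s_def[symmetric] by (simp add: power2_eq_square algebra_simps)
  then have "q * s powr (q - 2) * Re (z * cnj w) \<le> q * s powr (q - 2) * (s * (cmod (z + w) - s))"
    using assms by (intro mult_left_mono) auto
  also have "\<dots> = q * s powr (q - 1) * (cmod (z + w) - s)"
    using powr_add[of s "q - 2" 1] s by simp
  finally show ?thesis
    using powr_ge_tangent[OF assms, of s "cmod (z + w)"] s by (simp add: s_def)
qed (use assms in auto)

lemma powr_eq_powr_mult_square:
  fixes x q :: real
  assumes "0 \<le> x"
  shows "x powr q = x powr (q - 2) * x\<^sup>2"
  using assms powr_add[of x "q - 2" 2] by (cases "x = 0") auto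

lemma continuous_on_powr_scaleR:
  fixes f :: "real \<Rightarrow> complex"
  assumes "continuous_on A f" "0 \<le> s"
  shows "continuous_on A (\<lambda>x. (cmod (f x) powr s) *\<^sub>R f x)"
proof (cases "s = 0")
  case True
  then have "(\<lambda>x. (cmod (f x) powr s) *\<^sub>R f x) = f" by (auto simp: fun_eq_iff)
  then show ?thesis using assms by metis
next
  case False
  then show ?thesis using assms
    by (intro continuous_intros continuous_on_powr') auto
qed

lemma integrable_Re_mult_cnj:
  assumes "square_integrable f" "square_integrable g"
    and [measurable]: "V \<in> borel_measurable borel" and V: "\<And>x. \<bar>V x\<bar> \<le> K"
  shows "integrable lborel (\<lambda>x. V x * Re (f x * cnj (g x)))"
proof (rule Bochner_Integration.integrable_bound)
  have [measurable]: "f \<in> borel_measurable borel" "g \<in> borel_measurable borel"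
    using assms by (auto simp: square_integrable_def)
  show "integrable lborel (\<lambda>x. K * ((cmod (f x))\<^sup>2 + (cmod (g x))\<^sup>2))"
    using assms by (auto simp: square_integrable_def)
  have [measurable]: "cnj \<in> borel_measurable borel"
    by (intro borel_measurable_continuous_onI continuous_intros)
  show "(\<lambda>x. V x * Re (f x * cnj (g x))) \<in> borel_measurable lborel"
    by measurable
  show "AE x in lborel. norm (V x * Re (f x * cnj (g x))) \<le> norm (K * ((cmod (f x))\<^sup>2 + (cmod (g x))\<^sup>2))"
  proof (rule AE_I2)
    fix x
    have "\<bar>Re (f x * cnj (g x))\<bar> \<le> cmod (f x) * cmod (g x)"
      using abs_Re_le_cmod[of "f x * cnj (g x)"] by (simp add: norm_mult)
    also have "\<dots> \<le> (cmod (f x))\<^sup>2 + (cmod (g x))\<^sup>2"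
      using zero_le_power2[of "cmod (f x) - cmod (g x)"] zero_le_power2[of "cmod (f x) + cmod (g x)"]
      unfolding power2_diff power2_sum by linarith
    finally have "\<bar>V x\<bar> * \<bar>Re (f x * cnj (g x))\<bar> \<le> K * ((cmod (f x))\<^sup>2 + (cmod (g x))\<^sup>2)"
      using V[of x] by (intro mult_mono) auto
    then show "norm (V x * Re (f x * cnj (g x))) \<le> norm (K * ((cmod (f x))\<^sup>2 + (cmod (g x))\<^sup>2))"
      using V[of x] by (simp add: abs_mult)
  qed
qed

text \<open>Here |f|^q is |f|^(q-2), bounded because f is, times the integrable function
  |f|^2.\<close>

lemma H1_powr_integrable:
  assumes f: "f \<in> H1" and q: "2 \<le> q"
    and [measurable]: "V \<in> borel_measurable borel" and V: "\<And>x. \<bar>V x\<bar> \<le> K"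
  shows "integrable lborel (\<lambda>x. V x * cmod (f x) powr q)"
proof -
  obtain M where M: "M > 0" "\<And>x. cmod (f x) \<le> M"
    using H1_bounded[OF H1D[OF f]] by blast
  have [measurable]: "f \<in> borel_measurable borel"
    using H1D(2)[OF f] by (auto simp: square_integrable_def)
  have le: "cmod (f x) powr (q - 2) \<le> M powr (q - 2)" for x
    using M q by (intro powr_mono2) auto
  have "integrable lborel (\<lambda>x. (V x * cmod (f x) powr (q - 2)) * Re (f x * cnj (f x)))"
  proof (rule integrable_Re_mult_cnj[where K = "K * M powr (q - 2)"])
    show "\<bar>V x * cmod (f x) powr (q - 2)\<bar> \<le> K * M powr (q - 2)" for x
      using V[of x] le[of x] by (auto simp: abs_mult intro!: mult_mono)
  qed (use H1D(2)[OF f] in measurable)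
  moreover have "Re (f x * cnj (f x)) = (cmod (f x))\<^sup>2" for x
    unfolding cmod_power2 by (simp add: power2_eq_square)
  ultimately show ?thesis
    by (simp add: powr_eq_powr_mult_square[of "cmod _" q] mult.assoc)
qed

text \<open>The terms of the energy that involve one given component: \<alpha> is its diagonal
  coefficient, \<open>W\<close> the weighted sum of the p-th powers of the other moduli. The factor
  2 counts the row and the column of the symmetric matrix.\<close>

definition component_energy :: "real \<Rightarrow> real \<Rightarrow> (real \<Rightarrow> real) \<Rightarrow> (real \<Rightarrow> complex) \<Rightarrow> real" where
  "component_energy p \<alpha> W f = (LINT x|lborel. (cmod (weak_derivative f x))\<^sup>2)
     - 1 / p * (\<alpha> * (LINT x|lborel. cmod (f x) powr (2 * p)) + 2 * (LINT x|lborel. W x * cmod (f x) powr p))"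

lemma cmod_sq_add_scaled:
  "(cmod (z + of_real e * w))\<^sup>2 = (cmod z)\<^sup>2 + 2 * e * Re (z * cnj w) + e\<^sup>2 * (cmod w)\<^sup>2"
  unfolding cmod_power2 by (simp add: power2_eq_square algebra_simps)

lemma integral_cmod_sq_add_scaled:
  assumes "square_integrable f" "square_integrable h"
  shows "(LINT x|lborel. (cmod (f x + of_real e * h x))\<^sup>2)
    = (LINT x|lborel. (cmod (f x))\<^sup>2) + 2 * e * (LINT x|lborel. Re (f x * cnj (h x)))
      + e\<^sup>2 * (LINT x|lborel. (cmod (h x))\<^sup>2)"
  using assms integrable_Re_mult_cnj[OF assms, of "\<lambda>_. 1" 1]
  by (simp add: cmod_sq_add_scaled square_integrable_def del: times_complex.simps)

text \<open>A locale, because it is instantiated both at a component of the minimizer and, with the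
  same p, \<alpha>, K and W, at its modulus. \<open>f_pos\<close> permits the renormalization and
  rules out the zero solution.\<close>

locale component_minimizer =
  fixes p \<alpha> K :: real and W :: "real \<Rightarrow> real" and f :: "real \<Rightarrow> complex"
  assumes p: "2 \<le> p" and \<alpha>: "0 \<le> \<alpha>"
    and contW: "continuous_on UNIV W" and W: "\<And>x. 0 \<le> W x" "\<And>x. W x \<le> K"
    and f: "f \<in> H1" and f_pos: "0 < (LINT x|lborel. (cmod (f x))\<^sup>2)"
    and minimal: "\<And>h. h \<in> H1 \<Longrightarrow> (LINT x|lborel. (cmod (h x))\<^sup>2) = (LINT x|lborel. (cmod (f x))\<^sup>2)
      \<Longrightarrow> component_energy p \<alpha> W f \<le> component_energy p \<alpha> W h"
begin

text \<open>For \<open>p = 2\<close> the convention \<open>0 powr 0 = 0\<close> makes the potential discontinuous at zeros of \<open>f\<close>;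
  the product with \<open>f\<close> is continuous nevertheless.\<close>

definition potential :: "real \<Rightarrow> real" where
  "potential x = \<alpha> * cmod (f x) powr (2 * p - 2) + W x * cmod (f x) powr (p - 2)"

text \<open>The Lagrange multiplier. Its value is forced by testing the equation with f
  itself.\<close>

definition frequency :: real where
  "frequency = (\<alpha> * (LINT x|lborel. cmod (f x) powr (2 * p)) + (LINT x|lborel. W x * cmod (f x) powr p)
     - (LINT x|lborel. (cmod (weak_derivative f x))\<^sup>2)) / (LINT x|lborel. (cmod (f x))\<^sup>2)"

text \<open>With this sign the equation reads f'' = - \<open>residual\<close>.\<close>

definition residual :: "real \<Rightarrow> complex" where
  "residual x = (potential x - frequency) *\<^sub>R f x"

lemma contf: "continuous_on A f"
  using H1D(1)[OF f] continuous_on_subset by blast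

lemma measurable_f [measurable]: "f \<in> borel_measurable borel"
  and measurable_W [measurable]: "W \<in> borel_measurable borel"
  using contf contW by (auto intro: borel_measurable_continuous_onI)

lemma absW: "\<bar>W x\<bar> \<le> K"
  using W[of x] by simp

lemma bounded_powr:
  assumes "0 \<le> s"
  obtains B where "\<And>x. \<bar>cmod (f x) powr s\<bar> \<le> B"
proof -
  obtain M where M: "M > 0" "\<And>x. cmod (f x) \<le> M"
    using H1_bounded[OF H1D[OF f]] by blast
  have "\<bar>cmod (f x) powr s\<bar> \<le> M powr s" for x
    using M assms by (auto intro: powr_mono2)
  then show ?thesis using that by blast
qed

lemma bounded_W_powr:
  assumes "0 \<le> s"
  obtains B where "\<And>x. \<bar>W x * cmod (f x) powr s\<bar> \<le> B"
proof -
  obtain B where B: "\<And>x. \<bar>cmod (f x) powr s\<bar> \<le> B" using bounded_powr[OF assms] by blast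
  have "\<bar>W x * cmod (f x) powr s\<bar> \<le> K * B" for x
    unfolding abs_mult using absW[of x] B[of x] by (intro mult_mono) auto
  then show ?thesis using that by blast
qed

lemma continuous_residual: "continuous_on A residual"
proof -
  have "continuous_on A (\<lambda>x. \<alpha> *\<^sub>R ((cmod (f x) powr (2 * p - 2)) *\<^sub>R f x)
      + W x *\<^sub>R ((cmod (f x) powr (p - 2)) *\<^sub>R f x) - frequency *\<^sub>R f x)"
    using p by (intro continuous_intros continuous_on_powr_scaleR contf continuous_on_subset[OF contW]) auto
  moreover have "(\<lambda>x. \<alpha> *\<^sub>R ((cmod (f x) powr (2 * p - 2)) *\<^sub>R f x)
      + W x *\<^sub>R ((cmod (f x) powr (p - 2)) *\<^sub>R f x) - frequency *\<^sub>R f x) = residual"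
    by (simp add: fun_eq_iff residual_def potential_def scaleR_diff_left scaleR_add_left)
  ultimately show ?thesis by metis
qed

text \<open>Stated for arbitrary weak derivatives \<open>g\<close> and \<open>k\<close>, so that
  explicit ones can be inserted. Real parts appear because the perturbation parameter is real;
  complex directions h recover the full equation.\<close>

lemma Euler_Lagrange_weak:
  assumes g: "is_weak_derivative_L2 f g"
    and h: "continuous_on UNIV h" "square_integrable h" "is_weak_derivative_L2 h k"
  shows "(LINT x|lborel. Re (g x * cnj (k x))) = (LINT x|lborel. Re (residual x * cnj (h x)))"
proof -
  define r where "r = (LINT x|lborel. (cmod (f x))\<^sup>2)"
  define A0 where "A0 = (LINT x|lborel. (cmod (g x))\<^sup>2)"
  define a1 where "a1 = (LINT x|lborel. Re (g x * cnj (k x)))"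
  define a2 where "a2 = (LINT x|lborel. (cmod (k x))\<^sup>2)"
  define b1 where "b1 = (LINT x|lborel. Re (f x * cnj (h x)))"
  define c where "c = (LINT x|lborel. (cmod (h x))\<^sup>2)"
  define B0 where "B0 = (LINT x|lborel. cmod (f x) powr (2 * p))"
  define C0 where "C0 = (LINT x|lborel. W x * cmod (f x) powr p)"
  define \<beta> where "\<beta> = (LINT x|lborel. cmod (f x) powr (2 * p - 2) * Re (f x * cnj (h x)))"
  define \<gamma> where "\<gamma> = (LINT x|lborel. W x * cmod (f x) powr (p - 2) * Re (f x * cnj (h x)))"
  \<comment> \<open>The ratio of the squared norms of f + e h and f; dividing f + e h by its square
    root restores the norm of f.\<close>
  define n where "n e = (r + 2 * e * b1 + e\<^sup>2 * c) / r" for e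
  \<comment> \<open>The Dirichlet integral is kept exactly, both power integrals are replaced by
    their tangents at e = 0. Scaling by \<open>1 / sqrt (n e)\<close> contributes the exponents -1,
    -p and -p/2, matching the degrees 2, 2p and p.\<close>
  define U where "U e = (A0 + 2 * e * a1 + e\<^sup>2 * a2) / n e
    - 1 / p * (\<alpha> * ((B0 + e * (2 * p * \<beta>)) * n e powr (- p)) + 2 * ((C0 + e * (p * \<gamma>)) * n e powr (- (p / 2))))" for e
  have r: "r > 0" using f_pos by (simp add: r_def)
  have sqf: "square_integrable f" using H1D(2)[OF f] .
  have sqg: "square_integrable g" and sqk: "square_integrable k"
    using g h by (auto simp: is_weak_derivative_L2_def)
  have [measurable]: "h \<in> borel_measurable borel" using h(2) by (auto simp: square_integrable_def)
  obtain B1 where B1: "\<And>x. \<bar>cmod (f x) powr (2 * p - 2)\<bar> \<le> B1" using bounded_powr[of "2 * p - 2"] p by auto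
  obtain B2 where B2: "\<And>x. \<bar>W x * cmod (f x) powr (p - 2)\<bar> \<le> B2" using bounded_W_powr[of "p - 2"] p by auto
  have int\<beta>: "integrable lborel (\<lambda>x. cmod (f x) powr (2 * p - 2) * Re (f x * cnj (h x)))"
    by (rule integrable_Re_mult_cnj[OF sqf h(2) _ B1]) measurable
  have int\<gamma>: "integrable lborel (\<lambda>x. W x * cmod (f x) powr (p - 2) * Re (f x * cnj (h x)))"
    by (rule integrable_Re_mult_cnj[OF sqf h(2) _ B2]) measurable
  have intb: "integrable lborel (\<lambda>x. Re (f x * cnj (h x)))"
    using integrable_Re_mult_cnj[OF sqf h(2), of "\<lambda>_. 1" 1] by simp
  have E0: "component_energy p \<alpha> W f = A0 - 1 / p * (\<alpha> * B0 + 2 * C0)"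
    unfolding component_energy_def A0_def B0_def C0_def weak_derivative_energy_eq[OF f g] ..
  have upper: "component_energy p \<alpha> W f \<le> U e" if e: "n e > 0" for e
  proof -
    define u where "u x = f x + of_real e * h x" for x
    define m where "m = complex_of_real (1 / sqrt (n e))"
    have wu: "is_weak_derivative_L2 u (\<lambda>x. g x + of_real e * k x)"
      unfolding u_def
      by (intro is_weak_derivative_L2_add is_weak_derivative_L2_mult_const g h contf continuous_intros)
    have u: "u \<in> H1"
      by (rule H1I[OF _ _ wu]; unfold u_def)
         (intro contf continuous_intros h square_integrable_add square_integrable_mult_const sqf)+
    have wmu: "is_weak_derivative_L2 (\<lambda>x. m * u x) (\<lambda>x. m * (g x + of_real e * k x))"
      by (rule is_weak_derivative_L2_mult_const[OF wu])
    have mu: "(\<lambda>x. m * u x) \<in> H1"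
      by (rule H1I[OF _ _ wmu]) (use H1D[OF u] in \<open>auto intro!: continuous_intros square_integrable_mult_const\<close>)
    have m2: "(cmod (m * z))\<^sup>2 = (cmod z)\<^sup>2 / n e" for z
      using e by (simp add: m_def norm_mult power_mult_distrib norm_divide power_divide)
    have mq: "cmod (m * z) powr q = n e powr (- (q / 2)) * cmod z powr q" for z q
    proof -
      have "cmod m = n e powr (- (1 / 2))"
        using e by (simp add: m_def norm_divide powr_half_sqrt powr_minus inverse_eq_divide)
      then show ?thesis by (simp add: norm_mult powr_mult powr_powr)
    qed
    have "(LINT x|lborel. (cmod (m * u x))\<^sup>2) = (r + 2 * e * b1 + e\<^sup>2 * c) / n e"
      unfolding m2 u_def integral_divide_zero integral_cmod_sq_add_scaled[OF sqf h(2)] r_def b1_def c_def ..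
    also have "\<dots> = r" using r e by (auto simp: n_def)
    finally have "component_energy p \<alpha> W f \<le> component_energy p \<alpha> W (\<lambda>x. m * u x)"
      by (intro minimal mu) (simp add: r_def)
    also have "\<dots> = (A0 + 2 * e * a1 + e\<^sup>2 * a2) / n e
        - 1 / p * (\<alpha> * ((LINT x|lborel. cmod (u x) powr (2 * p)) * n e powr (- p))
          + 2 * ((LINT x|lborel. W x * cmod (u x) powr p) * n e powr (- (p / 2))))"
    proof -
      have "(LINT x|lborel. (cmod (weak_derivative (\<lambda>x. m * u x) x))\<^sup>2) = (A0 + 2 * e * a1 + e\<^sup>2 * a2) / n e"
        unfolding weak_derivative_energy_eq[OF mu wmu] m2 integral_divide_zero
          integral_cmod_sq_add_scaled[OF sqg sqk] A0_def a1_def a2_def ..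
      moreover have "(LINT x|lborel. cmod (m * u x) powr (2 * p))
          = (LINT x|lborel. cmod (u x) powr (2 * p)) * n e powr (- p)"
        unfolding mq by simp
      moreover have "(LINT x|lborel. W x * cmod (m * u x) powr p)
          = (LINT x|lborel. W x * cmod (u x) powr p) * n e powr (- (p / 2))"
        unfolding mq mult.left_commute[of "W _"] by simp
      ultimately show ?thesis by (simp add: component_energy_def)
    qed
    also have "\<dots> \<le> U e"
    proof -
      have "B0 + e * (2 * p * \<beta>) = (LINT x|lborel. cmod (f x) powr (2 * p)
          + e * (2 * p) * (cmod (f x) powr (2 * p - 2) * Re (f x * cnj (h x))))"
        using int\<beta> H1_powr_integrable[OF f, of "2 * p" "\<lambda>_. 1" 1] p
        by (simp add: B0_def \<beta>_def del: times_complex.simps)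
      also have "\<dots> \<le> (LINT x|lborel. cmod (u x) powr (2 * p))"
      proof (rule integral_mono)
        show "integrable lborel (\<lambda>x. cmod (f x) powr (2 * p)
            + e * (2 * p) * (cmod (f x) powr (2 * p - 2) * Re (f x * cnj (h x))))"
          using int\<beta> H1_powr_integrable[OF f, of "2 * p" "\<lambda>_. 1" 1] p by (simp del: times_complex.simps)
        show "integrable lborel (\<lambda>x. cmod (u x) powr (2 * p))"
          using H1_powr_integrable[OF u, of "2 * p" "\<lambda>_. 1" 1] p by simp
        show "cmod (f x) powr (2 * p) + e * (2 * p) * (cmod (f x) powr (2 * p - 2) * Re (f x * cnj (h x)))
            \<le> cmod (u x) powr (2 * p)" for x
          using cmod_powr_ge_tangent[of "2 * p" "f x" "of_real e * h x"] p
          by (simp add: u_def algebra_simps)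
      qed
      finally have 1: "\<alpha> * ((B0 + e * (2 * p * \<beta>)) * n e powr (- p))
          \<le> \<alpha> * ((LINT x|lborel. cmod (u x) powr (2 * p)) * n e powr (- p))"
        by (intro mult_left_mono mult_right_mono \<alpha>) auto
      have "C0 + e * (p * \<gamma>) = (LINT x|lborel. W x * cmod (f x) powr p
          + e * p * (W x * cmod (f x) powr (p - 2) * Re (f x * cnj (h x))))"
        using int\<gamma> H1_powr_integrable[OF f p measurable_W absW]
        by (simp add: C0_def \<gamma>_def del: times_complex.simps)
      also have "\<dots> \<le> (LINT x|lborel. W x * cmod (u x) powr p)"
      proof (rule integral_mono)
        show "integrable lborel (\<lambda>x. W x * cmod (f x) powr p
            + e * p * (W x * cmod (f x) powr (p - 2) * Re (f x * cnj (h x))))"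
          using int\<gamma> H1_powr_integrable[OF f p measurable_W absW] by (simp del: times_complex.simps)
        show "integrable lborel (\<lambda>x. W x * cmod (u x) powr p)"
          using H1_powr_integrable[OF u p measurable_W absW] .
        show "W x * cmod (f x) powr p + e * p * (W x * cmod (f x) powr (p - 2) * Re (f x * cnj (h x)))
            \<le> W x * cmod (u x) powr p" for x
          using mult_left_mono[OF cmod_powr_ge_tangent[of p "f x" "of_real e * h x"] W(1)[of x]] p
          by (simp add: u_def algebra_simps)
      qed
      finally have 2: "2 * ((C0 + e * (p * \<gamma>)) * n e powr (- (p / 2)))
          \<le> 2 * ((LINT x|lborel. W x * cmod (u x) powr p) * n e powr (- (p / 2)))"
        by (intro mult_left_mono mult_right_mono) auto
      show ?thesis
        unfolding U_def using p by (intro diff_left_mono mult_left_mono add_mono 1 2) auto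
    qed
    finally show ?thesis .
  qed
  have n0: "n 0 = 1" using r by (simp add: n_def)
  have dn: "(n has_real_derivative 2 * b1 / r) (at 0)"
    unfolding n_def using r by (auto intro!: derivative_eq_intros)
  \<comment> \<open>Renormalizing needs \<open>n e > 0\<close>, which continuity gives near 0. This
    suffices: there \<open>U\<close> lies above the energy of f and equals it at 0, so 0 is a local
    minimum.\<close>
  have "isCont n 0" using dn by (rule DERIV_isCont)
  then have "eventually (\<lambda>e. n e > 0) (at 0)"
    using n0 by (intro order_tendstoD(1)[of n "n 0"]) (auto simp: isCont_def)
  then obtain d where d: "d > 0" "\<And>e. e \<noteq> 0 \<Longrightarrow> \<bar>e\<bar> < d \<Longrightarrow> n e > 0"
    unfolding eventually_at by (auto simp: dist_real_def)
  then have d: "d > 0" "\<And>e. \<bar>0 - e\<bar> < d \<Longrightarrow> n e > 0"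
    using n0 by (auto, metis zero_less_one)
  have U0: "U 0 = component_energy p \<alpha> W f" by (simp add: U_def n0 E0)
  have npow: "((\<lambda>e. n e powr s) has_real_derivative s * (2 * b1 / r)) (at 0)" for s
    using has_real_derivative_powr'[OF dn DERIV_const[of s]] n0 by (simp add: mult_ac)
  have "(U has_real_derivative 2 * a1 - A0 * (2 * b1 / r)
      - 1 / p * (\<alpha> * (2 * p * \<beta> - p * B0 * (2 * b1 / r)) + 2 * (p * \<gamma> - p / 2 * C0 * (2 * b1 / r)))) (at 0)"
    unfolding U_def
    by (rule derivative_eq_intros dn npow refl | simp add: n0)+ (simp add: algebra_simps)
  then have "2 * a1 - A0 * (2 * b1 / r)
      - 1 / p * (\<alpha> * (2 * p * \<beta> - p * B0 * (2 * b1 / r)) + 2 * (p * \<gamma> - p / 2 * C0 * (2 * b1 / r))) = 0"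
    using upper d by (intro DERIV_local_min[of U _ 0 d]) (auto simp: U0)
  then have "a1 = \<alpha> * \<beta> + \<gamma> - frequency * b1"
  proof -
    assume *: "2 * a1 - A0 * (2 * b1 / r)
      - 1 / p * (\<alpha> * (2 * p * \<beta> - p * B0 * (2 * b1 / r)) + 2 * (p * \<gamma> - p / 2 * C0 * (2 * b1 / r))) = 0"
    have "frequency = (\<alpha> * B0 + C0 - A0) / r"
      unfolding frequency_def B0_def C0_def A0_def r_def weak_derivative_energy_eq[OF f g] ..
    moreover define \<nu> where "\<nu> = b1 / r"
    ultimately have freq: "frequency * b1 = (\<alpha> * B0 + C0 - A0) * \<nu>" by simp
    have \<nu>: "2 * b1 / r = 2 * \<nu>" by (simp add: \<nu>_def)
    have eq: "1 / p * (\<alpha> * (2 * p * \<beta> - p * B0 * (2 * \<nu>)) + 2 * (p * \<gamma> - p / 2 * C0 * (2 * \<nu>)))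
        = 2 * (\<alpha> * \<beta> - \<alpha> * B0 * \<nu> + \<gamma> - C0 * \<nu>)"
      using p by (simp add: field_simps)
    have "a1 - A0 * \<nu> = \<alpha> * \<beta> - \<alpha> * B0 * \<nu> + \<gamma> - C0 * \<nu>"
      using *[unfolded \<nu> eq] by simp
    then show ?thesis unfolding freq by (simp add: algebra_simps)
  qed
  also have "\<dots> = (LINT x|lborel. Re (residual x * cnj (h x)))"
  proof -
    have "Re (residual x * cnj (h x)) = \<alpha> * (cmod (f x) powr (2 * p - 2) * Re (f x * cnj (h x)))
        + W x * cmod (f x) powr (p - 2) * Re (f x * cnj (h x)) - frequency * Re (f x * cnj (h x))" for x
      by (simp add: residual_def potential_def algebra_simps)
    then show ?thesis
      using int\<beta> int\<gamma> intb by (simp add: \<beta>_def \<gamma>_def b1_def del: times_complex.simps)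
  qed
  finally show ?thesis by (simp add: a1_def)
qed

end

section \<open>Tents and the classical form of the equation\<close>

text \<open>Piecewise affine with values 0, 1, 0 at a, b, c. The slope is a step function, so
  testing against a derivative yields a difference of two difference quotients, whatever the
  regularity of that derivative.\<close>

definition tent :: "real \<Rightarrow> real \<Rightarrow> real \<Rightarrow> real \<Rightarrow> real" where
  "tent a b c x = max 0 (min ((x - a) / (b - a)) ((c - x) / (c - b)))"

text \<open>The values at a, b and c are arbitrary as far as derivatives are concerned; these points
  form a null set and go into the exceptional set of the fundamental theorem.\<close>

definition tent_slope :: "real \<Rightarrow> real \<Rightarrow> real \<Rightarrow> real \<Rightarrow> real" where
  "tent_slope a b c x = indicator {a..b} x / (b - a) - indicator {b..c} x / (c - b)"

lemma continuous_tent: "continuous_on A (tent a b c)"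
  unfolding tent_def divide_inverse by (intro continuous_intros)

lemma tent_cases:
  assumes "a < b" "b < c"
  shows "x \<le> a \<Longrightarrow> tent a b c x = 0" "c \<le> x \<Longrightarrow> tent a b c x = 0"
    "a \<le> x \<Longrightarrow> x \<le> b \<Longrightarrow> tent a b c x = (x - a) / (b - a)"
    "b \<le> x \<Longrightarrow> x \<le> c \<Longrightarrow> tent a b c x = (c - x) / (c - b)"
proof -
  show "tent a b c x = 0" if "x \<le> a"
  proof -
    have "(x - a) / (b - a) \<le> 0" using that assms by (simp add: divide_nonpos_pos)
    then show ?thesis by (simp add: tent_def)
  qed
  show "tent a b c x = 0" if "c \<le> x"
  proof -
    have "(c - x) / (c - b) \<le> 0" using that assms by (simp add: divide_nonpos_pos)
    then show ?thesis by (simp add: tent_def)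
  qed
  show "tent a b c x = (x - a) / (b - a)" if "a \<le> x" "x \<le> b"
  proof -
    have "0 \<le> (x - a) / (b - a)" "(x - a) / (b - a) \<le> 1" "1 \<le> (c - x) / (c - b)"
      using that assms by (auto simp: field_simps)
    then show ?thesis by (simp add: tent_def)
  qed
  show "tent a b c x = (c - x) / (c - b)" if "b \<le> x" "x \<le> c"
  proof -
    have "0 \<le> (c - x) / (c - b)" "(c - x) / (c - b) \<le> 1" "1 \<le> (x - a) / (b - a)"
      using that assms by (auto simp: field_simps)
    then show ?thesis by (simp add: tent_def)
  qed
qed

lemma tent_has_derivative:
  assumes abc: "a < b" "b < c" and x: "x \<notin> {a, b, c}"
  shows "(tent a b c has_real_derivative tent_slope a b c x) (at x)"
proof -
  consider "x < a" | "a < x" "x < b" | "b < x" "x < c" | "c < x" using x by fastforce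
  then show ?thesis
  proof cases
    case 1
    have "(tent a b c has_real_derivative 0) (at x)"
      by (rule has_field_derivative_transform_within_open[OF DERIV_const[of 0], where S = "{..<a}"])
         (use 1 abc in \<open>auto simp: tent_cases\<close>)
    then show ?thesis using 1 abc by (simp add: tent_slope_def)
  next
    case 2
    have "((\<lambda>x. (x - a) / (b - a)) has_real_derivative 1 / (b - a)) (at x)"
      using abc by (auto intro!: derivative_eq_intros)
    then have "(tent a b c has_real_derivative 1 / (b - a)) (at x)"
      by (rule has_field_derivative_transform_within_open[where S = "{a<..<b}"])
         (use 2 abc in \<open>auto simp: tent_cases\<close>)
    then show ?thesis using 2 abc by (simp add: tent_slope_def)
  next
    case 3
    have "((\<lambda>x. (c - x) / (c - b)) has_real_derivative - 1 / (c - b)) (at x)"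
      by (rule DERIV_cdivide) (auto intro!: derivative_eq_intros)
    then have "(tent a b c has_real_derivative - 1 / (c - b)) (at x)"
      by (rule has_field_derivative_transform_within_open[where S = "{b<..<c}"])
         (use 3 abc in \<open>auto simp: tent_cases\<close>)
    then show ?thesis using 3 abc by (simp add: tent_slope_def)
  next
    case 4
    have "(tent a b c has_real_derivative 0) (at x)"
      by (rule has_field_derivative_transform_within_open[OF DERIV_const[of 0], where S = "{c<..}"])
         (use 4 abc in \<open>auto simp: tent_cases\<close>)
    then show ?thesis using 4 abc by (simp add: tent_slope_def)
  qed
qed

text \<open>The factor 1 gives the bound the shape \<open>K * indicator {a..b} x\<close> in which
  the integrability lemmas expect it.\<close>

lemma tent_bound:
  assumes "a < b" "b < c"
  shows "\<bar>tent a b c x\<bar> \<le> 1 * indicator {a..c} x"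
proof -
  consider "x < a" | "a \<le> x" "x \<le> b" | "b \<le> x" "x \<le> c" | "c < x" by fastforce
  then show ?thesis using assms by cases (auto simp: tent_cases)
qed

lemma square_integrable_real_bounded_support:
  fixes h :: "real \<Rightarrow> real"
  assumes [measurable]: "h \<in> borel_measurable borel" and h: "\<And>x. \<bar>h x\<bar> \<le> K * indicator {a..b} x"
  shows "square_integrable (\<lambda>x. complex_of_real (h x))"
proof -
  have "integrable lborel (\<lambda>x. (cmod (complex_of_real (h x)))\<^sup>2)"
  proof (rule Bochner_Integration.integrable_bound)
    show "integrable lborel (\<lambda>x. K\<^sup>2 * indicator {a..b} x :: real)"
      by (cases "a \<le> b") auto
    show "AE x in lborel. norm ((cmod (complex_of_real (h x)))\<^sup>2) \<le> norm (K\<^sup>2 * indicator {a..b} x :: real)"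
    proof (rule AE_I2)
      fix x
      show "norm ((cmod (complex_of_real (h x)))\<^sup>2) \<le> norm (K\<^sup>2 * indicator {a..b} x :: real)"
        using h[of x] power_mono[OF h[of x], of 2] by (cases "x \<in> {a..b}") auto
    qed
  qed measurable
  then show ?thesis by (simp add: square_integrable_def)
qed

lemma tent_slope_bound:
  assumes "a < b" "b < c"
  shows "\<bar>tent_slope a b c x\<bar> \<le> (1 / (b - a) + 1 / (c - b)) * indicator {a..c} x"
proof -
  define u v where "u = 1 / (b - a)" and "v = 1 / (c - b)"
  have "u > 0" "v > 0" using assms by (auto simp: u_def v_def)
  moreover have "tent_slope a b c x = indicator {a..b} x * u - indicator {b..c} x * v"
    by (simp add: tent_slope_def u_def v_def)
  ultimately have "\<bar>tent_slope a b c x\<bar> \<le> (u + v) * indicator {a..c} x"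
    using assms by (auto simp: indicator_def)
  then show ?thesis by (simp add: u_def v_def)
qed

lemma measurable_tent [measurable]: "tent a b c \<in> borel_measurable borel"
    "tent_slope a b c \<in> borel_measurable borel"
  by (auto simp: tent_slope_def[abs_def] intro: borel_measurable_continuous_onI continuous_tent)

lemma tent_weak_derivative:
  assumes "a < b" "b < c"
  shows "is_weak_derivative_L2 (\<lambda>x. complex_of_real (tent a b c x)) (\<lambda>x. complex_of_real (tent_slope a b c x))"
proof (rule is_weak_derivative_L2_if_deriv[of _ "{a, b, c}"])
  show "((\<lambda>x. complex_of_real (tent a b c x)) has_vector_derivative complex_of_real (tent_slope a b c x)) (at x)"
    if "x \<notin> {a, b, c}" for x
    by (intro has_vector_derivative_of_real tent_has_derivative assms that)
  show "square_integrable (\<lambda>x. complex_of_real (tent_slope a b c x))"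
    by (rule square_integrable_real_bounded_support[OF _ tent_slope_bound[OF assms]]) measurable
qed (auto intro!: continuous_intros continuous_tent)

text \<open>Only interval integrals of G are prescribed, because the lemma serves both f with its
  weak derivative and the classical comparison function.\<close>

lemma integral_tent_slope:
  fixes G :: "real \<Rightarrow> complex"
  assumes abc: "a < b" "b < c"
    and G: "\<And>a b. a \<le> b \<Longrightarrow> (LINT x|lborel. indicator {a..b} x *\<^sub>R G x) = F b - F a"
    and int: "\<And>a b. integrable lborel (\<lambda>x. indicator {a..b} x *\<^sub>R G x)"
  shows "(LINT x|lborel. tent_slope a b c x *\<^sub>R G x)
    = (F b - F a) /\<^sub>R (b - a) - (F c - F b) /\<^sub>R (c - b)"
proof -
  have "tent_slope a b c x *\<^sub>R G x
      = (indicator {a..b} x *\<^sub>R G x) /\<^sub>R (b - a) - (indicator {b..c} x *\<^sub>R G x) /\<^sub>R (c - b)" for x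
    by (simp add: tent_slope_def scaleR_diff_left divide_inverse mult.commute)
  then have "(LINT x|lborel. tent_slope a b c x *\<^sub>R G x)
      = (LINT x|lborel. (indicator {a..b} x *\<^sub>R G x) /\<^sub>R (b - a) - (indicator {b..c} x *\<^sub>R G x) /\<^sub>R (c - b))"
    by (intro Bochner_Integration.integral_cong) auto
  also have "\<dots> = (LINT x|lborel. indicator {a..b} x *\<^sub>R G x) /\<^sub>R (b - a)
      - (LINT x|lborel. indicator {b..c} x *\<^sub>R G x) /\<^sub>R (c - b)"
    by (subst Bochner_Integration.integral_diff) (use int in \<open>simp_all only: integrable_scaleR_right integral_scaleR_right\<close>)
  finally show ?thesis using G[of a b] G[of b c] abc by simp
qed

text \<open>The three points x, 0, 1, taken in increasing order, determine F x from F 0 and F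
  1.\<close>

lemma affine_if_equal_slopes:
  fixes F :: "real \<Rightarrow> complex"
  assumes eq: "\<And>a b c. a < b \<Longrightarrow> b < c \<Longrightarrow> (F b - F a) /\<^sub>R (b - a) = (F c - F b) /\<^sub>R (c - b)"
  shows "F x = F 0 + x *\<^sub>R (F 1 - F 0)"
proof -
  consider "x < 0" | "x = 0" | "0 < x" "x < 1" | "x = 1" | "1 < x" by fastforce
  then show ?thesis
  proof cases
    case 1
    have "- x *\<^sub>R ((F 0 - F x) /\<^sub>R (0 - x)) = - x *\<^sub>R ((F 1 - F 0) /\<^sub>R (1 - 0))"
      using eq[of x 0 1] 1 by simp
    then show ?thesis using 1 by (simp add: algebra_simps)
  next
    case 3
    \<comment> \<open>The factor x (1 - x) clears the denominators of both slopes.\<close>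
    have "(x * (1 - x)) *\<^sub>R ((F x - F 0) /\<^sub>R (x - 0)) = (x * (1 - x)) *\<^sub>R ((F 1 - F x) /\<^sub>R (1 - x))"
      using eq[of 0 x 1] 3 by simp
    moreover have "x * (1 - x) * inverse (x - 0) = 1 - x" "x * (1 - x) * inverse (1 - x) = x"
      using 3 by (auto simp: field_simps)
    ultimately have "(1 - x) *\<^sub>R (F x - F 0) = x *\<^sub>R (F 1 - F x)"
      unfolding scaleR_scaleR by metis
    then show ?thesis by (simp add: algebra_simps)
  next
    case 5
    have "(x - 1) *\<^sub>R ((F 1 - F 0) /\<^sub>R (1 - 0)) = (x - 1) *\<^sub>R ((F x - F 1) /\<^sub>R (x - 1))"
      using eq[of 0 1 x] 5 by simp
    moreover have "(x - 1) * inverse (x - 1) = 1" using 5 by simp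
    ultimately have "(x - 1) *\<^sub>R (F 1 - F 0) = F x - F 1"
      unfolding scaleR_scaleR by simp
    then show ?thesis by (simp add: algebra_simps)
  qed auto
qed

lemma antiderivative_exists:
  fixes q :: "real \<Rightarrow> complex"
  assumes "continuous_on UNIV q"
  obtains Q where "\<And>x. (Q has_vector_derivative q x) (at x)"
proof -
  have "\<exists>F. \<forall>x. - \<infinity> < ereal x \<longrightarrow> ereal x < \<infinity> \<longrightarrow> (F has_vector_derivative q x) (at x)"
    by (rule einterval_antiderivative) (use assms in \<open>auto simp: continuous_on_eq_continuous_at\<close>)
  then show ?thesis using that by auto
qed

lemma restrict_integrable_continuous:
  fixes f :: "real \<Rightarrow> complex"
  assumes "continuous_on UNIV f"
  shows "integrable lborel (\<lambda>x. indicator {a..b} x *\<^sub>R f x)"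
  by (intro borel_integrable_compact continuous_on_subset[OF assms]) auto

context component_minimizer
begin

lemma Euler_Lagrange_tent:
  assumes abc: "a < b" "b < c"
  shows "(f b - f a) /\<^sub>R (b - a) - (f c - f b) /\<^sub>R (c - b) = (LINT x|lborel. tent a b c x *\<^sub>R residual x)"
proof -
  define g where "g = weak_derivative f"
  have g: "is_weak_derivative_L2 f g" unfolding g_def using H1D(3)[OF f] .
  have sqg: "square_integrable g" using g by (auto simp: is_weak_derivative_L2_def)
  \<comment> \<open>The directions \<open>d = 1\<close> and \<open>d = \<i>\<close> give the real
    and the imaginary part of the equation.\<close>
  have eq: "(LINT x|lborel. Re (g x * cnj (d * complex_of_real (tent_slope a b c x))))
      = (LINT x|lborel. Re (residual x * cnj (d * complex_of_real (tent a b c x))))" for d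
  proof (rule Euler_Lagrange_weak[OF g])
    show "is_weak_derivative_L2 (\<lambda>x. d * complex_of_real (tent a b c x)) (\<lambda>x. d * complex_of_real (tent_slope a b c x))"
      by (intro is_weak_derivative_L2_mult_const tent_weak_derivative abc)
    show "square_integrable (\<lambda>x. d * complex_of_real (tent a b c x))"
      by (intro square_integrable_mult_const square_integrable_real_bounded_support[OF _ tent_bound[OF abc]])
         measurable
  qed (intro continuous_intros continuous_tent)
  have i1: "integrable lborel (\<lambda>x. tent_slope a b c x *\<^sub>R g x)"
    by (rule square_integrable_mult_bounded_support[OF sqg _ tent_slope_bound[OF abc]]) measurable
  have i2: "integrable lborel (\<lambda>x. tent a b c x *\<^sub>R residual x)"
    by (rule integrable_bounded_support_mult_cont[OF continuous_tent tent_bound[OF abc] continuous_residual])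
  have "Re (LINT x|lborel. tent_slope a b c x *\<^sub>R g x) = Re (LINT x|lborel. tent a b c x *\<^sub>R residual x)"
    unfolding integral_Re[OF i1, symmetric] integral_Re[OF i2, symmetric]
    using eq[of 1] by (simp add: mult.commute)
  moreover have "Im (LINT x|lborel. tent_slope a b c x *\<^sub>R g x) = Im (LINT x|lborel. tent a b c x *\<^sub>R residual x)"
    unfolding integral_Im[OF i1, symmetric] integral_Im[OF i2, symmetric]
    using eq[of \<i>] by (simp add: mult.commute)
  ultimately have "(LINT x|lborel. tent_slope a b c x *\<^sub>R g x) = (LINT x|lborel. tent a b c x *\<^sub>R residual x)"
    by (rule complex_eqI)
  then show ?thesis
    using integral_tent_slope[OF abc, of g f] weak_derivative_FTC[OF contf g]
      square_integrable_restrict_integrable[OF sqg] by simp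
qed

lemma Euler_Lagrange:
  obtains f' where "\<And>x. (f has_vector_derivative f' x) (at x)"
    "\<And>x. (f' has_vector_derivative (frequency - potential x) *\<^sub>R f x) (at x)"
proof -
  \<comment> \<open>Integrating - \<open>residual\<close> twice gives the C^2 comparison function
    \<open>Q2\<close>.\<close>
  obtain Q1 where Q1: "\<And>x. (Q1 has_vector_derivative - residual x) (at x)"
    using antiderivative_exists[of "\<lambda>x. - residual x"] continuous_residual
    by (auto intro: continuous_intros)
  have contQ1: "continuous_on A Q1" for A
    using Q1 by (blast intro: continuous_at_imp_continuous_on has_vector_derivative_continuous)
  obtain Q2 where Q2: "\<And>x. (Q2 has_vector_derivative Q1 x) (at x)"
    using antiderivative_exists[OF contQ1] by blast
  have contQ2: "continuous_on A Q2" for A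
    using Q2 by (blast intro: continuous_at_imp_continuous_on has_vector_derivative_continuous)
  \<comment> \<open>Integration by parts against the tent shows that \<open>Q2\<close> obeys the
    very identity proved for f. Hence f - Q2 has equal slopes on adjacent intervals and is
    affine.\<close>
  have Q2_tent: "(Q2 b - Q2 a) /\<^sub>R (b - a) - (Q2 c - Q2 b) /\<^sub>R (c - b) = (LINT x|lborel. tent a b c x *\<^sub>R residual x)"
    if abc: "a < b" "b < c" for a b c
  proof -
    have FTC: "(LINT x|lborel. indicator {a..b} x *\<^sub>R Q1 x) = Q2 b - Q2 a" if "a \<le> b" for a b
      by (rule FTC_lborel[of "{}"]) (auto intro: that Q2 contQ2 restrict_integrable_continuous contQ1)
    have i1: "integrable lborel (\<lambda>x. tent_slope a b c x *\<^sub>R Q1 x)"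
    proof -
      have "tent_slope a b c x *\<^sub>R (indicator {a..c} x *\<^sub>R Q1 x) = tent_slope a b c x *\<^sub>R Q1 x" for x
        using tent_slope_bound[OF abc, of x] by (cases "x \<in> {a..c}") auto
      then have "(\<lambda>x. tent_slope a b c x *\<^sub>R (indicator {a..c} x *\<^sub>R Q1 x)) = (\<lambda>x. tent_slope a b c x *\<^sub>R Q1 x)"
        by (rule ext)
      moreover have "integrable lborel (\<lambda>x. tent_slope a b c x *\<^sub>R (indicator {a..c} x *\<^sub>R Q1 x))"
      proof (rule Bochner_Integration.integrable_bound)
        show "integrable lborel (\<lambda>x. (1 / (b - a) + 1 / (c - b)) *\<^sub>R norm (indicator {a..c} x *\<^sub>R Q1 x))"
          by (intro integrable_scaleR_right integrable_norm restrict_integrable_continuous contQ1)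
        have [measurable]: "Q1 \<in> borel_measurable borel"
          using contQ1 by (auto intro: borel_measurable_continuous_onI)
        show "(\<lambda>x. tent_slope a b c x *\<^sub>R (indicator {a..c} x *\<^sub>R Q1 x)) \<in> borel_measurable lborel"
          by measurable
        show "AE x in lborel. norm (tent_slope a b c x *\<^sub>R (indicator {a..c} x *\<^sub>R Q1 x))
            \<le> norm ((1 / (b - a) + 1 / (c - b)) *\<^sub>R norm (indicator {a..c} x *\<^sub>R Q1 x))"
        proof (rule AE_I2)
          fix x
          show "norm (tent_slope a b c x *\<^sub>R (indicator {a..c} x *\<^sub>R Q1 x))
            \<le> norm ((1 / (b - a) + 1 / (c - b)) *\<^sub>R norm (indicator {a..c} x *\<^sub>R Q1 x))"
            using tent_slope_bound[OF abc, of x] abc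
            by (cases "x \<in> {a..c}") (auto intro!: mult_right_mono)
        qed
      qed
      ultimately show ?thesis by (simp only:)
    qed
    have i2: "integrable lborel (\<lambda>x. tent a b c x *\<^sub>R residual x)"
      by (rule integrable_bounded_support_mult_cont[OF continuous_tent tent_bound[OF abc] continuous_residual])
    have ind: "(\<lambda>x. indicator {a..c} x *\<^sub>R (tent a b c x *\<^sub>R (- residual x) + tent_slope a b c x *\<^sub>R Q1 x))
        = (\<lambda>x. tent a b c x *\<^sub>R (- residual x) + tent_slope a b c x *\<^sub>R Q1 x)"
    proof
      fix x
      show "indicator {a..c} x *\<^sub>R (tent a b c x *\<^sub>R (- residual x) + tent_slope a b c x *\<^sub>R Q1 x)
        = tent a b c x *\<^sub>R (- residual x) + tent_slope a b c x *\<^sub>R Q1 x"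
        using tent_slope_bound[OF abc, of x] tent_bound[OF abc, of x] by (cases "x \<in> {a..c}") auto
    qed
    have "(LINT x|lborel. indicator {a..c} x *\<^sub>R (tent a b c x *\<^sub>R (- residual x) + tent_slope a b c x *\<^sub>R Q1 x))
        = tent a b c c *\<^sub>R Q1 c - tent a b c a *\<^sub>R Q1 a"
    proof (rule FTC_lborel[of "{a, b, c}"])
      show "((\<lambda>x. tent a b c x *\<^sub>R Q1 x) has_vector_derivative
          tent a b c x *\<^sub>R (- residual x) + tent_slope a b c x *\<^sub>R Q1 x) (at x)" if "x \<in> {a..c} - {a, b, c}" for x
        by (intro has_vector_derivative_scaleR tent_has_derivative Q1 abc) (use that in auto)
      show "integrable lborel (\<lambda>x. indicator {a..c} x *\<^sub>R
          (tent a b c x *\<^sub>R (- residual x) + tent_slope a b c x *\<^sub>R Q1 x))"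
        unfolding ind using i1 i2 by simp
    qed (use abc in \<open>auto intro!: continuous_intros continuous_tent contQ1\<close>)
    then have "(LINT x|lborel. tent_slope a b c x *\<^sub>R Q1 x) = (LINT x|lborel. tent a b c x *\<^sub>R residual x)"
      unfolding ind using i1 i2 abc by (simp add: tent_cases)
    then show ?thesis
      using integral_tent_slope[OF abc FTC restrict_integrable_continuous[OF contQ1]] by simp
  qed
  define F where "F x = f x - Q2 x" for x
  have "F x = F 0 + x *\<^sub>R (F 1 - F 0)" for x
  proof (rule affine_if_equal_slopes)
    fix a b c :: real assume abc: "a < b" "b < c"
    show "(F b - F a) /\<^sub>R (b - a) = (F c - F b) /\<^sub>R (c - b)"
      using Q2_tent[OF abc] Euler_Lagrange_tent[OF abc] unfolding F_def by (simp add: algebra_simps)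
  qed
  then have f_eq: "f = (\<lambda>x. Q2 x + (F 0 + x *\<^sub>R (F 1 - F 0)))"
    by (auto simp: fun_eq_iff F_def algebra_simps)
  show ?thesis
  proof (rule that[of "\<lambda>x. Q1 x + (F 1 - F 0)"])
    show "(f has_vector_derivative Q1 x + (F 1 - F 0)) (at x)" for x
      by (subst f_eq) (auto intro!: derivative_eq_intros Q2)
    show "((\<lambda>x. Q1 x + (F 1 - F 0)) has_vector_derivative (frequency - potential x) *\<^sub>R f x) (at x)" for x
    proof -
      have "(frequency - potential x) *\<^sub>R f x = - residual x + 0"
        by (simp add: residual_def scaleR_diff_left)
      then show ?thesis
        by (auto intro!: derivative_eq_intros Q1)
    qed
  qed
qed

end

section \<open>The modulus of a minimizer\<close>

text \<open>The classical and the weak derivative integrate to the same increments of f, so they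
  agree almost everywhere and share square integrability.\<close>

lemma square_integrable_if_C1:
  fixes f :: "real \<Rightarrow> complex"
  assumes g: "is_weak_derivative_L2 f g" and d: "\<And>x. (f has_vector_derivative f' x) (at x)"
    and cont: "continuous_on UNIV f'"
  shows "square_integrable f'"
proof -
  have contf: "continuous_on A f" for A
    using d by (blast intro: continuous_at_imp_continuous_on has_vector_derivative_continuous)
  have sq: "square_integrable g" using g by (auto simp: is_weak_derivative_L2_def)
  then have [measurable]: "g \<in> borel_measurable borel" by (auto simp: square_integrable_def)
  have [measurable]: "f' \<in> borel_measurable borel"
    using cont by (rule borel_measurable_continuous_onI)
  have "AE x in lborel. g x = f' x"
  proof (rule AE_eq_if_interval_integrals_eq)
    show "integrable lborel (\<lambda>x. indicator {a..b} x *\<^sub>R f' x)" for a b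
      by (rule restrict_integrable_continuous[OF cont])
    then have "(LINT x|lborel. indicator {a..b} x *\<^sub>R f' x) = f b - f a" if "a \<le> b" for a b
      by (intro FTC_lborel[of "{}"] that d contf) auto
    then show "(LINT x|lborel. indicator {a..b} x *\<^sub>R g x) = (LINT x|lborel. indicator {a..b} x *\<^sub>R f' x)"
      if "a \<le> b" for a b
      using weak_derivative_FTC[OF contf g that] that by simp
  qed (auto intro: square_integrable_restrict_integrable[OF sq])
  then have "AE x in lborel. (cmod (g x))\<^sup>2 = (cmod (f' x))\<^sup>2" by (rule eventually_mono) simp
  then have "integrable lborel (\<lambda>x. (cmod (f' x))\<^sup>2)"
    using sq integrable_cong_AE[of "\<lambda>x. (cmod (g x))\<^sup>2" lborel "\<lambda>x. (cmod (f' x))\<^sup>2"]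
    by (simp add: square_integrable_def)
  then show ?thesis by (simp add: square_integrable_def)
qed

lemma cmod_sq_has_derivative:
  assumes "(f has_vector_derivative f') (at x)"
  shows "((\<lambda>x. (cmod (f x))\<^sup>2) has_real_derivative 2 * Re (f' * cnj (f x))) (at x)"
proof -
  have d: "((\<lambda>x. Re (f x)) has_real_derivative Re f') (at x)" "((\<lambda>x. Im (f x)) has_real_derivative Im f') (at x)"
    using bounded_linear.has_vector_derivative[OF bounded_linear_Re assms]
      bounded_linear.has_vector_derivative[OF bounded_linear_Im assms]
    by (auto simp: has_real_derivative_iff_has_vector_derivative)
  show ?thesis
    unfolding cmod_power2
    by (rule DERIV_cong[OF DERIV_add[OF DERIV_power[OF d(1)] DERIV_power[OF d(2)]]]) simp
qed

text \<open>At zeros of \<open>f\<close> the quotient is \<open>0\<close> by the convention \<open>x / 0 = 0\<close>, as it should be.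
  The weak derivative is obtained as the limit of the derivatives of \<open>sqrt (|f|\<^sup>2 + \<epsilon>\<^sup>2)\<close>.\<close>

lemma modulus_weak_derivative:
  fixes f :: "real \<Rightarrow> complex"
  assumes d: "\<And>x. (f has_vector_derivative f' x) (at x)"
    and cont: "continuous_on UNIV f'" and sq: "square_integrable f'"
  shows "is_weak_derivative_L2 (\<lambda>x. complex_of_real (cmod (f x)))
    (\<lambda>x. complex_of_real (Re (f' x * cnj (f x)) / cmod (f x)))"
proof -
  define m where "m x = Re (f' x * cnj (f x)) / cmod (f x)" for x
  define e where "e n = (inverse (real (Suc n)))" for n
  define F where "F n x = sqrt ((cmod (f x))\<^sup>2 + (e n)\<^sup>2)" for n x
  define G where "G n x = Re (f' x * cnj (f x)) / F n x" for n x
  have contf: "continuous_on A f" for A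
    using d by (blast intro: continuous_at_imp_continuous_on has_vector_derivative_continuous)
  have [measurable]: "f \<in> borel_measurable borel" "f' \<in> borel_measurable borel" "cnj \<in> borel_measurable borel"
    by (intro borel_measurable_continuous_onI cont contf continuous_intros)+
  have e: "e n > 0" "e n \<le> 1" for n by (auto simp: e_def inverse_le_1_iff)
  have elim: "e \<longlonglongrightarrow> 0" unfolding e_def by (rule LIMSEQ_inverse_real_of_nat)
  have Fpos: "F n x > 0" for n x
    unfolding F_def using e[of n] by (simp add: add_nonneg_pos)
  have Fge: "cmod (f x) \<le> F n x" for n x
    unfolding F_def by (rule real_le_rsqrt) simp
  \<comment> \<open>Uniform in n because e n <= 1; this supplies the dominating function for
    \<open>F n\<close>.\<close>
  have Fle: "F n x \<le> cmod (f x) + 1" for n x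
  proof -
    have "F n x \<le> cmod (f x) + e n"
      unfolding F_def using e[of n] by (intro real_le_lsqrt) (auto simp: power2_sum)
    then show ?thesis using e[of n] by simp
  qed
  have Flim: "(\<lambda>n. F n x) \<longlonglongrightarrow> cmod (f x)" for x
  proof -
    have "(\<lambda>n. F n x) \<longlonglongrightarrow> sqrt ((cmod (f x))\<^sup>2 + 0\<^sup>2)"
      unfolding F_def by (intro tendsto_intros elim)
    then show ?thesis by simp
  qed
  have Re_le: "\<bar>Re (f' x * cnj (f x))\<bar> \<le> cmod (f' x) * cmod (f x)" for x
    using abs_Re_le_cmod[of "f' x * cnj (f x)"] by (simp add: norm_mult)
  have Gle: "\<bar>G n x\<bar> \<le> cmod (f' x)" for n x
  proof -
    have "\<bar>G n x\<bar> = \<bar>Re (f' x * cnj (f x))\<bar> / F n x"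
      unfolding G_def abs_divide using Fpos[of n x] by simp
    also have "\<dots> \<le> (cmod (f' x) * F n x) / F n x"
      using Re_le[of x] mult_left_mono[OF Fge[of x n] norm_ge_zero[of "f' x"]] Fpos[of n x]
      by (intro divide_right_mono) auto
    finally show ?thesis using Fpos[of n x] by simp
  qed
  have mle: "\<bar>m x\<bar> \<le> cmod (f' x)" for x
    using Re_le[of x] by (cases "f x = 0") (auto simp: m_def field_simps)
  \<comment> \<open>At a zero of f the numerator vanishes too, so \<open>G n x\<close> and
    \<open>m x\<close> are both 0, although the denominators tend to 0.\<close>
  have Glim: "(\<lambda>n. G n x) \<longlonglongrightarrow> m x" for x
  proof (cases "f x = 0")
    case True
    then show ?thesis by (simp add: G_def m_def)
  next
    case False
    then show ?thesis unfolding G_def m_def by (intro tendsto_intros Flim) auto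
  qed
  have contF: "continuous_on A (F n)" for n A
    unfolding F_def by (intro continuous_intros contf)
  have dF: "(F n has_real_derivative G n x) (at x)" for n x
  proof -
    define N where "N x = (cmod (f x))\<^sup>2 + (e n)\<^sup>2" for x
    have N: "N x > 0" using e[of n] by (simp add: N_def add_nonneg_pos)
    have "(N has_real_derivative 2 * Re (f' x * cnj (f x))) (at x)"
      unfolding N_def[abs_def]
      using DERIV_add[OF cmod_sq_has_derivative[OF d[of x]] DERIV_const[of "(e n)\<^sup>2"]] by simp
    from DERIV_chain2[OF DERIV_real_sqrt[OF N] this]
    have "((\<lambda>x. sqrt (N x)) has_real_derivative
        inverse (sqrt (N x)) / 2 * (2 * Re (f' x * cnj (f x)))) (at x)" .
    also have "inverse (sqrt (N x)) / 2 * (2 * Re (f' x * cnj (f x))) = G n x"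
      unfolding G_def F_def N_def by (simp add: inverse_eq_divide del: times_complex.simps)
    also have "(\<lambda>x. sqrt (N x)) = F n"
      by (simp add: fun_eq_iff F_def N_def)
    finally show ?thesis .
  qed
  have sqm: "square_integrable (\<lambda>x. complex_of_real (m x))"
  proof -
    have "integrable lborel (\<lambda>x. (cmod (complex_of_real (m x)))\<^sup>2)"
    proof (rule Bochner_Integration.integrable_bound)
      show "integrable lborel (\<lambda>x. (cmod (f' x))\<^sup>2)" using sq by (simp add: square_integrable_def)
      show "(\<lambda>x. (cmod (complex_of_real (m x)))\<^sup>2) \<in> borel_measurable lborel" unfolding m_def by measurable
      show "AE x in lborel. norm ((cmod (complex_of_real (m x)))\<^sup>2) \<le> norm ((cmod (f' x))\<^sup>2)"
        using mle by (intro AE_I2) (simp add: abs_le_square_iff[symmetric] del: power2_abs)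
    qed
    moreover have "(\<lambda>x. complex_of_real (m x)) \<in> borel_measurable lborel" unfolding m_def by measurable
    ultimately show ?thesis by (simp add: square_integrable_def)
  qed
  have "(LINT x|lborel. deriv \<psi> x *\<^sub>R complex_of_real (cmod (f x))) = - (LINT x|lborel. \<psi> x *\<^sub>R complex_of_real (m x))"
    if \<psi>: "\<psi> \<in> test_functions" for \<psi>
  proof -
    obtain R K where "R > 0" "K \<ge> 0" "\<psi> R = 0" "\<psi> (- R) = 0"
      "\<And>x. \<bar>\<psi> x\<bar> \<le> K * indicator {- R..R} x" "\<And>x. \<bar>deriv \<psi> x\<bar> \<le> K * indicator {- R..R} x"
      and c: "continuous_on UNIV \<psi>" "continuous_on UNIV (deriv \<psi>)"
      and "\<And>x. (\<psi> has_real_derivative deriv \<psi> x) (at x)"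
      by (rule test_functionE[OF \<psi>]) blast
    have [measurable]: "\<psi> \<in> borel_measurable borel" "deriv \<psi> \<in> borel_measurable borel"
      using c by (auto intro: borel_measurable_continuous_onI)
    have int\<psi>: "integrable lborel (\<lambda>x. norm (\<psi> x *\<^sub>R f' x))"
      by (intro integrable_norm test_function_mult_square_integrable[OF \<psi> sq])
    have [measurable]: "F n \<in> borel_measurable borel" "G n \<in> borel_measurable borel" for n
      unfolding F_def[abs_def] G_def[abs_def] by measurable
    have int\<psi>G: "integrable lborel (\<lambda>x. \<psi> x *\<^sub>R complex_of_real (G n x))" for n
      by (rule Bochner_Integration.integrable_bound[OF int\<psi>])
         (use Gle in \<open>auto intro!: mult_left_mono simp: abs_mult\<close>)
    have eq: "(LINT x|lborel. deriv \<psi> x *\<^sub>R complex_of_real (F n x)) = - (LINT x|lborel. \<psi> x *\<^sub>R complex_of_real (G n x))" for n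
      by (rule test_function_integration_by_parts[OF \<psi> _ finite.emptyI _ int\<psi>G])
         (auto intro!: continuous_intros contF has_vector_derivative_of_real dF)
    have lim1: "(\<lambda>n. LINT x|lborel. deriv \<psi> x *\<^sub>R complex_of_real (F n x))
        \<longlonglongrightarrow> (LINT x|lborel. deriv \<psi> x *\<^sub>R complex_of_real (cmod (f x)))"
    proof (rule integral_dominated_convergence[where w = "\<lambda>x. norm (deriv \<psi> x *\<^sub>R complex_of_real (cmod (f x) + 1))"])
      show "integrable lborel (\<lambda>x. norm (deriv \<psi> x *\<^sub>R complex_of_real (cmod (f x) + 1)))"
        by (intro integrable_norm deriv_test_function_mult_cont[OF \<psi>] continuous_intros contf)
      show "AE x in lborel. (\<lambda>n. deriv \<psi> x *\<^sub>R complex_of_real (F n x)) \<longlonglongrightarrow> deriv \<psi> x *\<^sub>R complex_of_real (cmod (f x))"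
        by (intro AE_I2 tendsto_intros Flim)
      show "AE x in lborel. norm (deriv \<psi> x *\<^sub>R complex_of_real (F n x)) \<le> norm (deriv \<psi> x *\<^sub>R complex_of_real (cmod (f x) + 1))" for n
      proof (rule AE_I2)
        fix x
        have "\<bar>F n x\<bar> \<le> \<bar>cmod (f x) + 1\<bar>" using Fle[of n x] Fpos[of n x] by simp
        then show "norm (deriv \<psi> x *\<^sub>R complex_of_real (F n x)) \<le> norm (deriv \<psi> x *\<^sub>R complex_of_real (cmod (f x) + 1))"
          unfolding norm_scaleR norm_of_real by (intro mult_left_mono) auto
      qed
    qed measurable
    have lim2: "(\<lambda>n. LINT x|lborel. \<psi> x *\<^sub>R complex_of_real (G n x))
        \<longlonglongrightarrow> (LINT x|lborel. \<psi> x *\<^sub>R complex_of_real (m x))"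
    proof (rule integral_dominated_convergence[OF _ _ int\<psi>])
      show "AE x in lborel. (\<lambda>n. \<psi> x *\<^sub>R complex_of_real (G n x)) \<longlonglongrightarrow> \<psi> x *\<^sub>R complex_of_real (m x)"
        by (intro AE_I2 tendsto_intros Glim)
      show "AE x in lborel. norm (\<psi> x *\<^sub>R complex_of_real (G n x)) \<le> norm (\<psi> x *\<^sub>R f' x)" for n
        using Gle by (auto intro!: AE_I2 mult_left_mono)
      show "(\<lambda>x. \<psi> x *\<^sub>R complex_of_real (m x)) \<in> borel_measurable lborel"
        unfolding m_def by measurable
    qed measurable
    show ?thesis
      using LIMSEQ_unique[OF lim1] tendsto_minus[OF lim2] unfolding eq by simp
  qed
  then show ?thesis using sqm by (simp add: is_weak_derivative_L2_def m_def)
qed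

section \<open>Positivity of the modulus and constancy of the phase\<close>

text \<open>Gronwall's argument for e = v^2 + w^2. Since e' = 2 v w (1 + c), |e'| is at most (1 + L)
  e, so e times exp (-(1 + L) x) is nonincreasing and e times exp ((1 + L) x) nondecreasing; the
  first settles the points right of a, the second those left of it. A bound on c stands in for
  continuity, which \<open>potential\<close> can lack at zeros of f.\<close>

lemma second_order_linear_ode_zero:
  fixes v w c :: "real \<Rightarrow> real"
  assumes v: "\<And>x. (v has_real_derivative w x) (at x)"
    and w: "\<And>x. (w has_real_derivative c x * v x) (at x)"
    and L: "\<And>x. \<bar>c x\<bar> \<le> L" and z: "v a = 0" "w a = 0"
  shows "v x = 0"
proof -
  define e where "e x = (v x)\<^sup>2 + (w x)\<^sup>2" for x
  define e' where "e' x = 2 * v x * w x * (1 + c x)" for x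
  have e: "(e has_real_derivative e' x) (at x)" for x
    unfolding e_def[abs_def] e'_def by (auto intro!: derivative_eq_intros v w simp: algebra_simps)
  have e'_le: "\<bar>e' x\<bar> \<le> (1 + L) * e x" for x
  proof -
    have "\<bar>2 * v x * w x\<bar> \<le> e x"
      using zero_le_power2[of "v x - w x"] zero_le_power2[of "v x + w x"]
      unfolding e_def power2_diff power2_sum by linarith
    moreover have "\<bar>1 + c x\<bar> \<le> 1 + L" using L[of x] by linarith
    ultimately have "\<bar>2 * v x * w x\<bar> * \<bar>1 + c x\<bar> \<le> e x * (1 + L)"
      by (intro mult_mono) (auto simp: e_def)
    then show ?thesis by (simp add: e'_def abs_mult mult.commute)
  qed
  have d: "((\<lambda>x. e x * exp (s * x)) has_real_derivative (e' x + s * e x) * exp (s * x)) (at x)" for s x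
    by (auto intro!: derivative_eq_intros e simp: algebra_simps)
  have "e x \<le> 0"
  proof (cases "a \<le> x")
    case True
    have "e x * exp (- (1 + L) * x) \<le> e a * exp (- (1 + L) * a)"
    proof (rule DERIV_nonpos_imp_nonincreasing[OF True, where f = "\<lambda>x. e x * exp (- (1 + L) * x)"])
      fix y
      have "(e' y + - (1 + L) * e y) * exp (- (1 + L) * y) \<le> 0"
        using e'_le[of y] by (intro mult_nonpos_nonneg) (auto simp: algebra_simps abs_le_iff)
      then show "\<exists>z. ((\<lambda>x. e x * exp (- (1 + L) * x)) has_real_derivative z) (at y) \<and> z \<le> 0"
        using d[of "- (1 + L)" y] by blast
    qed
    then show ?thesis using z by (simp add: e_def[of a] mult_le_0_iff)
  next
    case False
    have "e x * exp ((1 + L) * x) \<le> e a * exp ((1 + L) * a)"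
    proof (rule DERIV_nonneg_imp_nondecreasing[where f = "\<lambda>x. e x * exp ((1 + L) * x)"])
      show "x \<le> a" using False by simp
      fix y
      have "(e' y + (1 + L) * e y) * exp ((1 + L) * y) \<ge> 0"
        using e'_le[of y] by (intro mult_nonneg_nonneg) (auto simp: algebra_simps abs_le_iff)
      then show "\<exists>z. ((\<lambda>x. e x * exp ((1 + L) * x)) has_real_derivative z) (at y) \<and> 0 \<le> z"
        using d[of "1 + L" y] by blast
    qed
    then show ?thesis using z by (simp add: e_def[of a] mult_le_0_iff)
  qed
  then show ?thesis by (simp add: e_def sum_power2_le_zero_iff)
qed

text \<open>The zero set has full measure and is closed, hence it is the whole line.\<close>

lemma continuous_nonneg_integral_zero:
  fixes h :: "real \<Rightarrow> real"
  assumes "continuous_on UNIV h" "\<And>x. 0 \<le> h x" "integrable lborel h" "(LINT x|lborel. h x) = 0"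
  shows "h x = 0"
proof -
  have "AE x in lborel. h x = 0"
    using integral_nonneg_eq_0_iff_AE[OF assms(3)] assms(2,4) by auto
  then have "AE x in lebesgue. x \<in> {x. h x = 0}"
    by (auto intro: AE_completion)
  moreover have "closed {x. h x = 0}"
    using assms(1) by (intro closed_Collect_eq continuous_intros) auto
  ultimately show ?thesis
    using mem_closed_if_AE_lebesgue by blast
qed

context component_minimizer
begin

lemma potential_bounded:
  obtains L where "\<And>x. \<bar>frequency - potential x\<bar> \<le> L"
proof -
  obtain B1 where B1: "\<And>x. \<bar>cmod (f x) powr (2 * p - 2)\<bar> \<le> B1" using bounded_powr[of "2 * p - 2"] p by auto
  obtain B2 where B2: "\<And>x. \<bar>W x * cmod (f x) powr (p - 2)\<bar> \<le> B2" using bounded_W_powr[of "p - 2"] p by auto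
  have "\<bar>frequency - potential x\<bar> \<le> \<bar>frequency\<bar> + (\<alpha> * B1 + B2)" for x
  proof -
    have "\<bar>\<alpha> * cmod (f x) powr (2 * p - 2)\<bar> \<le> \<alpha> * B1"
      unfolding abs_mult using B1[of x] \<alpha> by (intro mult_mono) auto
    then show ?thesis using B2[of x] unfolding potential_def by linarith
  qed
  then show ?thesis using that by blast
qed

text \<open>When f equals its modulus, the modulus inherits differentiability from f even at zeros.
  A zero is then a minimum, hence a double zero, and uniqueness for the linear equation gives f = 0,
  against \<open>f_pos\<close>.\<close>

lemma nonneg_imp_positive:
  assumes real: "\<And>x. f x = complex_of_real (cmod (f x))"
  obtains \<phi>' where "\<And>x. cmod (f x) > 0"
    "\<And>x. ((\<lambda>x. cmod (f x)) has_real_derivative \<phi>' x) (at x)"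
    "\<And>x. (\<phi>' has_real_derivative (frequency - potential x) * cmod (f x)) (at x)"
proof -
  obtain f' where f': "\<And>x. (f has_vector_derivative f' x) (at x)"
    "\<And>x. (f' has_vector_derivative (frequency - potential x) *\<^sub>R f x) (at x)"
    using Euler_Lagrange by blast
  define \<phi> where "\<phi> x = cmod (f x)" for x
  have Re_f: "Re (f x) = \<phi> x" for x unfolding \<phi>_def by (metis real Re_complex_of_real)
  have 1: "(\<phi> has_real_derivative Re (f' x)) (at x)" for x
    using bounded_linear.has_vector_derivative[OF bounded_linear_Re f'(1)[of x]]
    by (simp add: Re_f has_real_derivative_iff_has_vector_derivative)
  have 2: "((\<lambda>x. Re (f' x)) has_real_derivative (frequency - potential x) * \<phi> x) (at x)" for x
    using bounded_linear.has_vector_derivative[OF bounded_linear_Re f'(2)[of x]]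
    by (simp add: Re_f has_real_derivative_iff_has_vector_derivative)
  obtain L where L: "\<And>x. \<bar>frequency - potential x\<bar> \<le> L" using potential_bounded by blast
  have "\<phi> a > 0" for a
  proof (rule ccontr)
    assume "\<not> \<phi> a > 0"
    then have a: "\<phi> a = 0" by (simp add: \<phi>_def)
    have "Re (f' a) = 0"
      by (rule DERIV_local_min[OF 1[of a] zero_less_one]) (use a in \<open>auto simp: \<phi>_def\<close>)
    then have "\<phi> x = 0" for x
      using second_order_linear_ode_zero[OF 1 2 L a] by blast
    then have "(LINT x|lborel. (cmod (f x))\<^sup>2) = 0" by (simp add: \<phi>_def)
    then show False using f_pos by simp
  qed
  then show ?thesis
    using that[of "\<lambda>x. Re (f' x)"] 1 2 unfolding \<phi>_def[abs_def] by blast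
qed

text \<open>Passing to the modulus changes only the Dirichlet integral and cannot raise it, while
  minimality of f forbids lowering it. So the two integrals agree, and the modulus is a minimizer
  too.\<close>

lemma modulus_minimizer:
  assumes f': "\<And>x. (f has_vector_derivative f' x) (at x)" and contf': "continuous_on UNIV f'"
  shows "component_minimizer p \<alpha> K W (\<lambda>x. complex_of_real (cmod (f x)))"
    and "integrable lborel (\<lambda>x. (cmod (f' x))\<^sup>2)"
    and "integrable lborel (\<lambda>x. (Re (f' x * cnj (f x)) / cmod (f x))\<^sup>2)"
    and "(LINT x|lborel. (cmod (f' x))\<^sup>2) = (LINT x|lborel. (Re (f' x * cnj (f x)) / cmod (f x))\<^sup>2)"
proof -
  define m where "m x = Re (f' x * cnj (f x)) / cmod (f x)" for x
  define u where "u x = complex_of_real (cmod (f x))" for x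
  have sq: "square_integrable f'" by (rule square_integrable_if_C1[OF H1D(3)[OF f] f' contf'])
  have wf: "is_weak_derivative_L2 f f'"
    by (rule is_weak_derivative_L2_if_deriv[OF contf finite.emptyI f' sq])
  have wu: "is_weak_derivative_L2 u (\<lambda>x. complex_of_real (m x))"
    unfolding u_def m_def by (rule modulus_weak_derivative[OF f' contf' sq])
  have [measurable]: "u \<in> borel_measurable borel" unfolding u_def[abs_def] by measurable
  have u: "u \<in> H1"
    by (rule H1I[OF _ _ wu])
       (use H1D(2)[OF f] in \<open>auto simp: u_def square_integrable_def intro!: continuous_intros contf\<close>)
  show int: "integrable lborel (\<lambda>x. (cmod (f' x))\<^sup>2)"
    using sq by (simp add: square_integrable_def)
  have intm: "integrable lborel (\<lambda>x. (m x)\<^sup>2)"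
    using wu by (simp add: is_weak_derivative_L2_def square_integrable_def)
  then show "integrable lborel (\<lambda>x. (Re (f' x * cnj (f x)) / cmod (f x))\<^sup>2)" by (simp add: m_def)
  have mle: "(m x)\<^sup>2 \<le> (cmod (f' x))\<^sup>2" for x
  proof -
    have "\<bar>Re (f' x * cnj (f x))\<bar> \<le> cmod (f' x) * cmod (f x)"
      using abs_Re_le_cmod[of "f' x * cnj (f x)"] by (simp add: norm_mult)
    then have "\<bar>m x\<bar> \<le> \<bar>cmod (f' x)\<bar>" by (cases "f x = 0") (auto simp: m_def field_simps)
    then show ?thesis by (simp only: abs_le_square_iff)
  qed
  have le: "(LINT x|lborel. (m x)\<^sup>2) \<le> (LINT x|lborel. (cmod (f' x))\<^sup>2)"
    by (intro integral_mono intm int mle)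
  have eu: "component_energy p \<alpha> W u = component_energy p \<alpha> W f
      + (LINT x|lborel. (m x)\<^sup>2) - (LINT x|lborel. (cmod (f' x))\<^sup>2)"
    unfolding component_energy_def weak_derivative_energy_eq[OF u wu] weak_derivative_energy_eq[OF f wf]
    by (simp add: u_def)
  have nu: "(LINT x|lborel. (cmod (u x))\<^sup>2) = (LINT x|lborel. (cmod (f x))\<^sup>2)"
    by (simp add: u_def)
  have "component_energy p \<alpha> W f \<le> component_energy p \<alpha> W u"
    by (intro minimal u nu)
  then show "(LINT x|lborel. (cmod (f' x))\<^sup>2) = (LINT x|lborel. (Re (f' x * cnj (f x)) / cmod (f x))\<^sup>2)"
    using eu le by (simp add: m_def)
  have "component_minimizer p \<alpha> K W u"
  proof
    show "component_energy p \<alpha> W u \<le> component_energy p \<alpha> W h"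
      if "h \<in> H1" "(LINT x|lborel. (cmod (h x))\<^sup>2) = (LINT x|lborel. (cmod (u x))\<^sup>2)" for h
      using minimal[OF that(1)] that(2) nu eu le by simp
  qed (use p \<alpha> contW W u nu f_pos in auto)
  then show "component_minimizer p \<alpha> K W (\<lambda>x. complex_of_real (cmod (f x)))"
    by (simp add: u_def[abs_def])
qed

text \<open>The locale is instantiated at the modulus. The potential depends on f only through |f|
  and is unchanged; \<omega> is the multiplier belonging to the modulus, and only its existence is
  recorded.\<close>

lemma modulus_ode:
  obtains \<omega> \<phi>' where "\<And>x. cmod (f x) > 0"
    "\<And>x. ((\<lambda>x. cmod (f x)) has_real_derivative \<phi>' x) (at x)"
    "\<And>x. (\<phi>' has_real_derivative (\<omega> - potential x) * cmod (f x)) (at x)"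
proof -
  obtain f' where f': "\<And>x. (f has_vector_derivative f' x) (at x)"
    "\<And>x. (f' has_vector_derivative (frequency - potential x) *\<^sub>R f x) (at x)"
    using Euler_Lagrange by blast
  have contf': "continuous_on UNIV f'"
    using f'(2) by (blast intro: continuous_at_imp_continuous_on has_vector_derivative_continuous)
  interpret u: component_minimizer p \<alpha> K W "\<lambda>x. complex_of_real (cmod (f x))"
    by (rule modulus_minimizer[OF f'(1) contf'])
  have pot: "u.potential x = potential x" for x
    by (simp add: potential_def u.potential_def)
  have "complex_of_real (cmod (f x)) = complex_of_real (cmod (complex_of_real (cmod (f x))))" for x
    by simp
  then obtain \<phi>' where \<phi>': "\<And>x. cmod (complex_of_real (cmod (f x))) > 0"
    "\<And>x. ((\<lambda>x. cmod (complex_of_real (cmod (f x)))) has_real_derivative \<phi>' x) (at x)"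
    "\<And>x. (\<phi>' has_real_derivative (u.frequency - u.potential x) * cmod (complex_of_real (cmod (f x)))) (at x)"
    by (rule u.nonneg_imp_positive) blast
  show ?thesis
    by (rule that[of \<phi>' u.frequency]) (use \<phi>' in \<open>simp_all add: pot\<close>)
qed

lemma constant_phase:
  obtains \<theta> where "\<And>x. f x = exp (\<i> * complex_of_real \<theta>) * complex_of_real (cmod (f x))"
proof -
  obtain f' where f': "\<And>x. (f has_vector_derivative f' x) (at x)"
    "\<And>x. (f' has_vector_derivative (frequency - potential x) *\<^sub>R f x) (at x)"
    using Euler_Lagrange by blast
  have contf': "continuous_on UNIV f'"
    using f'(2) by (blast intro: continuous_at_imp_continuous_on has_vector_derivative_continuous)
  obtain \<omega> \<phi>' where pos: "\<And>x. cmod (f x) > 0"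
    and d: "\<And>x. ((\<lambda>x. cmod (f x)) has_real_derivative \<phi>' x) (at x)"
    and "\<And>x. (\<phi>' has_real_derivative (\<omega> - potential x) * cmod (f x)) (at x)"
    by (rule modulus_ode) blast
  note mod = modulus_minimizer[OF f'(1) contf']
  define m where "m x = Re (f' x * cnj (f x)) / cmod (f x)" for x
  have nz: "f x \<noteq> 0" for x using pos[of x] by auto
  \<comment> \<open>In polar form f = \<phi> e^(i \<theta>), this is the splitting of |f'|^2 into
    the radial part (\<phi>')^2 and the angular part (\<phi> \<theta>')^2.\<close>
  have sq_eq: "(cmod (f' x))\<^sup>2 = (m x)\<^sup>2 + (Im (f' x * cnj (f x)) / cmod (f x))\<^sup>2" for x
  proof -
    have "(cmod (f' x) * cmod (f x))\<^sup>2 = (Re (f' x * cnj (f x)))\<^sup>2 + (Im (f' x * cnj (f x)))\<^sup>2"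
      unfolding cmod_power2[symmetric] by (simp add: norm_mult)
    then show ?thesis using pos[of x] nz[of x] by (simp add: m_def power_mult_distrib field_simps del: times_complex.simps)
  qed
  \<comment> \<open>Since f has no zeros, \<open>m\<close> is continuous; the nonnegative difference
    has integral 0 and therefore vanishes at every point, not just almost everywhere.\<close>
  have "(cmod (f' x))\<^sup>2 - (m x)\<^sup>2 = 0" for x
  proof (rule continuous_nonneg_integral_zero[where h = "\<lambda>x. (cmod (f' x))\<^sup>2 - (m x)\<^sup>2"])
    show "continuous_on UNIV (\<lambda>x. (cmod (f' x))\<^sup>2 - (m x)\<^sup>2)"
      unfolding m_def using nz by (intro continuous_intros contf' contf) auto
    show "0 \<le> (cmod (f' x))\<^sup>2 - (m x)\<^sup>2" for x unfolding sq_eq by simp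
    show "integrable lborel (\<lambda>x. (cmod (f' x))\<^sup>2 - (m x)\<^sup>2)"
      unfolding m_def by (intro Bochner_Integration.integrable_diff mod)
    show "(LINT x|lborel. (cmod (f' x))\<^sup>2 - (m x)\<^sup>2) = 0"
      unfolding m_def by (subst Bochner_Integration.integral_diff) (use mod in auto)
  qed
  then have Im0: "Im (f' x * cnj (f x)) = 0" for x
    unfolding sq_eq using nz by simp
  \<comment> \<open>The derivative of |f|^2 is computed in two ways; this settles the real part, and
    the imaginary part has just been shown to vanish.\<close>
  have \<phi>'_eq: "complex_of_real (\<phi>' x) * cmod (f x) = f' x * cnj (f x)" for x
  proof -
    have "((\<lambda>x. (cmod (f x))\<^sup>2) has_real_derivative 2 * cmod (f x) * \<phi>' x) (at x)"
      by (auto intro!: derivative_eq_intros d)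
    then have "2 * cmod (f x) * \<phi>' x = 2 * Re (f' x * cnj (f x))"
      by (rule DERIV_unique[OF _ cmod_sq_has_derivative[OF f'(1)]])
    then have "\<phi>' x * cmod (f x) = Re (f' x * cnj (f x))"
      by (simp add: mult.commute[of "\<phi>' x"] del: times_complex.simps)
    then have "complex_of_real (\<phi>' x * cmod (f x)) = f' x * cnj (f x)"
      using Im0[of x] by (intro complex_eqI) (simp_all del: times_complex.simps)
    then show ?thesis by simp
  qed
  define s where "s x = inverse (cmod (f x)) *\<^sub>R f x" for x
  have "(s has_vector_derivative 0) (at x)" for x
  proof -
    have "((\<lambda>x. inverse (cmod (f x))) has_real_derivative - (\<phi>' x / (cmod (f x))\<^sup>2)) (at x)"
      using nz by (auto intro!: derivative_eq_intros d simp: power2_eq_square divide_inverse)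
    from has_vector_derivative_scaleR[OF this f'(1)[of x]]
    have "(s has_vector_derivative inverse (cmod (f x)) *\<^sub>R f' x + (- (\<phi>' x / (cmod (f x))\<^sup>2)) *\<^sub>R f x) (at x)"
      unfolding s_def[abs_def] .
    also have "inverse (cmod (f x)) *\<^sub>R f' x + (- (\<phi>' x / (cmod (f x))\<^sup>2)) *\<^sub>R f x = 0"
    proof -
      have "f' x * (cmod (f x))\<^sup>2 = f' x * cnj (f x) * f x"
        unfolding complex_norm_square by simp
      also have "\<dots> = \<phi>' x * cmod (f x) * f x" unfolding \<phi>'_eq[symmetric] by simp
      finally have "f' x * cmod (f x) = \<phi>' x * f x"
        using nz[of x] by (simp add: power2_eq_square)
      then show ?thesis
        using nz[of x] by (simp add: scaleR_conv_of_real field_simps power2_eq_square)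
    qed
    finally show ?thesis .
  qed
  then have s_const: "s x = s 0" for x
    using has_vector_derivative_zero_constant[of UNIV s] by (metis UNIV_I convex_UNIV)
  have "cmod (s 0) = 1" using nz[of 0] by (simp add: s_def)
  then have "s 0 = cis (Arg (s 0))"
    using cis_Arg[of "s 0"] by (cases "s 0 = 0") (auto simp: sgn_div_norm)
  then have s0: "s 0 = exp (\<i> * complex_of_real (Arg (s 0)))"
    by (simp add: cis_conv_exp)
  have "s x * complex_of_real (cmod (f x)) = f x" for x
    using nz[of x] by (simp add: s_def scaleR_conv_of_real)
  then have "f x = s 0 * complex_of_real (cmod (f x))" for x
    by (metis s_const)
  then show ?thesis using that[of "Arg (s 0)"] s0 by simp
qed

end

section \<open>Bootstrapping\<close>

inductive ode_algebra :: "('i \<Rightarrow> real \<Rightarrow> real) \<Rightarrow> ('i \<Rightarrow> real \<Rightarrow> real) \<Rightarrow> (real \<Rightarrow> real) \<Rightarrow> bool"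
  for \<phi> \<phi>' where
  const: "ode_algebra \<phi> \<phi>' (\<lambda>x. c)"
| powr: "ode_algebra \<phi> \<phi>' (\<lambda>x. \<phi> j x powr s)"
| deriv: "ode_algebra \<phi> \<phi>' (\<phi>' j)"
| add: "ode_algebra \<phi> \<phi>' F \<Longrightarrow> ode_algebra \<phi> \<phi>' G \<Longrightarrow> ode_algebra \<phi> \<phi>' (\<lambda>x. F x + G x)"
| mult: "ode_algebra \<phi> \<phi>' F \<Longrightarrow> ode_algebra \<phi> \<phi>' G \<Longrightarrow> ode_algebra \<phi> \<phi>' (\<lambda>x. F x * G x)"

lemma ode_algebra_sum:
  assumes "finite A" "\<And>k. k \<in> A \<Longrightarrow> ode_algebra \<phi> \<phi>' (F k)"
  shows "ode_algebra \<phi> \<phi>' (\<lambda>x. \<Sum>k\<in>A. F k x)"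
  using assms by (induction A rule: finite_induct) (auto intro: ode_algebra.const ode_algebra.add)

text \<open>The algebra generated by the powers of the \<open>\<phi> j\<close> and by their derivatives is closed
  under differentiation as soon as it contains the second derivatives.\<close>

lemma ode_algebra_smooth:
  assumes pos: "\<And>j x. 0 < \<phi> j x"
    and d: "\<And>j x. (\<phi> j has_real_derivative \<phi>' j x) (at x)"
    and d2: "\<And>j x. (\<phi>' j has_real_derivative \<phi>'' j x) (at x)" "\<And>j. ode_algebra \<phi> \<phi>' (\<phi>'' j)"
    and "ode_algebra \<phi> \<phi>' F"
  shows "infinitely_differentiable F"
proof (rule infinitely_differentiableI_coinduct[where P = "ode_algebra \<phi> \<phi>'"])
  fix F assume "ode_algebra \<phi> \<phi>' F"
  then have "\<exists>F'. ode_algebra \<phi> \<phi>' F' \<and> (\<forall>x. (F has_real_derivative F' x) (at x))"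
  proof induction
    case (const c)
    show ?case by (intro exI[of _ "\<lambda>x. 0"]) (auto intro: ode_algebra.const)
  next
    case (powr j s)
    have D: "((\<lambda>x. \<phi> j x powr s) has_real_derivative (s * \<phi> j x powr (s - 1)) * \<phi>' j x) (at x)" for x
      by (rule DERIV_chain2[OF has_real_derivative_powr[OF pos] d])
    show ?case
      by (intro exI[of _ "\<lambda>x. (s * \<phi> j x powr (s - 1)) * \<phi>' j x"] conjI allI D
          ode_algebra.mult ode_algebra.const ode_algebra.powr ode_algebra.deriv)
  next
    case (deriv j)
    show ?case using d2 by blast
  next
    case (add F G)
    then obtain F' G' where "ode_algebra \<phi> \<phi>' F'" "\<And>x. (F has_real_derivative F' x) (at x)"
      "ode_algebra \<phi> \<phi>' G'" "\<And>x. (G has_real_derivative G' x) (at x)" by blast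
    then show ?case
      by (intro exI[of _ "\<lambda>x. F' x + G' x"]) (auto intro: ode_algebra.add DERIV_add)
  next
    case (mult F G)
    then obtain F' G' where "ode_algebra \<phi> \<phi>' F'" "\<And>x. (F has_real_derivative F' x) (at x)"
      "ode_algebra \<phi> \<phi>' G'" "\<And>x. (G has_real_derivative G' x) (at x)" by blast
    with mult.hyps show ?case
      by (intro exI[of _ "\<lambda>x. F' x * G x + G' x * F x"])
         (auto intro: ode_algebra.add ode_algebra.mult DERIV_mult)
  qed
  then show "\<exists>F'. ode_algebra \<phi> \<phi>' F' \<and> (\<forall>x. (F has_vector_derivative F' x) (at x))"
    by (simp add: has_real_derivative_iff_has_vector_derivative)
qed (fact assms(5))

section \<open>From the three-component problem to a single component\<close>

lemma norm_L2_eq_iff: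
  "norm_L2 f = norm_L2 g \<longleftrightarrow> (LINT x|lborel. (cmod (f x))\<^sup>2) = (LINT x|lborel. (cmod (g x))\<^sup>2)"
  by (simp add: norm_L2_def)

lemma sum_split_UNIV:
  fixes F :: "3 \<Rightarrow> real"
  shows "(\<Sum>i\<in>UNIV. F i) = F j + (\<Sum>i\<in>UNIV - {j}. F i)"
  by (rule sum.remove) auto

text \<open>The constant, chosen before h, is the integral of all terms free of the j-th component.
  Splitting the energy integral requires integrability of every piece, which holds because
  \<open>H1\<close> functions are bounded and square integrable.\<close>

lemma energy_fun_upd:
  fixes \<Phi> :: "3 \<Rightarrow> real \<Rightarrow> complex"
  assumes p: "2 \<le> p" and sym: "\<And>k j. a k j = a j k" and \<Phi>: "\<Phi> \<in> Y"
  obtains c where "\<And>h. h \<in> H1 \<Longrightarrow> energy p a (\<Phi>(j := h))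
    = component_energy p (a j j) (\<lambda>x. \<Sum>k\<in>UNIV - {j}. a k j * cmod (\<Phi> k x) powr p) h + c"
proof -
  define W where "W x = (\<Sum>k\<in>UNIV - {j}. a k j * cmod (\<Phi> k x) powr p)" for x
  define R where "R x = (\<Sum>i\<in>UNIV - {j}. (cmod (weak_derivative (\<Phi> i) x))\<^sup>2)
    - 1 / p * (\<Sum>k\<in>UNIV - {j}. \<Sum>i\<in>UNIV - {j}. a k i * cmod (\<Phi> k x) powr p * cmod (\<Phi> i x) powr p)" for x
  have H: "\<Phi> i \<in> H1" for i using \<Phi> by (simp add: Y_def)
  have meas [measurable]: "\<Phi> i \<in> borel_measurable borel" for i
    using H1D(2)[OF H[of i]] by (simp add: square_integrable_def)
  have wd: "integrable lborel (\<lambda>x. (cmod (weak_derivative f x))\<^sup>2)" if "f \<in> H1" for f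
    using H1D(3)[OF that] by (simp add: is_weak_derivative_L2_def square_integrable_def)
  have pw: "\<exists>K. \<forall>x. \<bar>a k i * cmod (\<Phi> k x) powr p\<bar> \<le> K" for k i
  proof -
    obtain M where M: "M > 0" "\<And>x. cmod (\<Phi> k x) \<le> M"
      using H1_bounded[OF H1D[OF H[of k]]] by blast
    have "\<bar>a k i * cmod (\<Phi> k x) powr p\<bar> \<le> \<bar>a k i\<bar> * M powr p" for x
      unfolding abs_mult using M p by (intro mult_mono) (auto intro: powr_mono2)
    then show ?thesis by blast
  qed
  have int2: "integrable lborel (\<lambda>x. a k i * cmod (\<Phi> k x) powr p * cmod (h x) powr p)" if h: "h \<in> H1" for k i h
  proof -
    obtain K where "\<And>x. \<bar>a k i * cmod (\<Phi> k x) powr p\<bar> \<le> K" using pw by blast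
    then show ?thesis by (intro H1_powr_integrable[OF h p]) measurable
  qed
  have intR: "integrable lborel R"
    unfolding R_def by (intro Bochner_Integration.integrable_diff integrable_mult_right
        Bochner_Integration.integrable_sum wd int2 H)
  have "energy p a (\<Phi>(j := h)) = component_energy p (a j j) W h + (LINT x|lborel. R x)" if h: "h \<in> H1" for h
  proof -
    have i1: "integrable lborel (\<lambda>x. cmod (h x) powr (2 * p))"
      using H1_powr_integrable[OF h, of "2 * p" "\<lambda>_. 1" 1] p by simp
    have i2: "integrable lborel (\<lambda>x. W x * cmod (h x) powr p)"
      unfolding W_def sum_distrib_right by (intro Bochner_Integration.integrable_sum int2 h)
    have pp: "cmod (h x) powr (2 * p) = cmod (h x) powr p * cmod (h x) powr p" for x
      by (simp add: powr_add[symmetric])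
    let ?\<Psi> = "\<Phi>(j := h)"
    have "(\<Sum>i\<in>UNIV. (cmod (weak_derivative (?\<Psi> i) x))\<^sup>2)
        - 1 / p * (\<Sum>k\<in>UNIV. \<Sum>i\<in>UNIV. a k i * cmod (?\<Psi> k x) powr p * cmod (?\<Psi> i x) powr p)
      = (cmod (weak_derivative h x))\<^sup>2
        - 1 / p * (a j j * cmod (h x) powr (2 * p) + 2 * (W x * cmod (h x) powr p)) + R x" for x
    proof -
      have 1: "(\<Sum>i\<in>UNIV. (cmod (weak_derivative (?\<Psi> i) x))\<^sup>2)
          = (cmod (weak_derivative h x))\<^sup>2 + (\<Sum>i\<in>UNIV - {j}. (cmod (weak_derivative (\<Phi> i) x))\<^sup>2)"
        by (subst sum_split_UNIV[of _ j]) auto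
      \<comment> \<open>Used twice, for the inner and for the outer sum.\<close>
      have row: "(\<Sum>i\<in>UNIV. b i * cmod (?\<Psi> i x) powr p)
          = b j * cmod (h x) powr p + (\<Sum>i\<in>UNIV - {j}. b i * cmod (\<Phi> i x) powr p)" for b
        by (subst sum_split_UNIV[of _ j]) auto
      have "(\<Sum>k\<in>UNIV. \<Sum>i\<in>UNIV. a k i * cmod (?\<Psi> k x) powr p * cmod (?\<Psi> i x) powr p)
          = (\<Sum>k\<in>UNIV. (a k j * cmod (h x) powr p + (\<Sum>i\<in>UNIV - {j}. a k i * cmod (\<Phi> i x) powr p)) * cmod (?\<Psi> k x) powr p)"
        unfolding row[symmetric] sum_distrib_right
        by (intro sum.cong refl) (simp add: mult_ac)
      also have "\<dots> = (a j j * cmod (h x) powr p + (\<Sum>i\<in>UNIV - {j}. a j i * cmod (\<Phi> i x) powr p)) * cmod (h x) powr p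
          + (\<Sum>k\<in>UNIV - {j}. (a k j * cmod (h x) powr p + (\<Sum>i\<in>UNIV - {j}. a k i * cmod (\<Phi> i x) powr p)) * cmod (\<Phi> k x) powr p)"
        by (rule row)
      \<comment> \<open>Symmetry turns this row sum into the column sum \<open>W\<close>, so the two
        cross terms merge with the factor 2.\<close>
      also have "(\<Sum>i\<in>UNIV - {j}. a j i * cmod (\<Phi> i x) powr p) = W x"
        unfolding W_def by (subst sym) (rule refl)
      also have "(\<Sum>k\<in>UNIV - {j}. (a k j * cmod (h x) powr p + (\<Sum>i\<in>UNIV - {j}. a k i * cmod (\<Phi> i x) powr p)) * cmod (\<Phi> k x) powr p)
          = W x * cmod (h x) powr p
            + (\<Sum>k\<in>UNIV - {j}. \<Sum>i\<in>UNIV - {j}. a k i * cmod (\<Phi> k x) powr p * cmod (\<Phi> i x) powr p)"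
        unfolding W_def sum_distrib_right sum_distrib_left distrib_right sum.distrib
        by (simp add: mult_ac)
      finally have 2: "(\<Sum>k\<in>UNIV. \<Sum>i\<in>UNIV. a k i * cmod (?\<Psi> k x) powr p * cmod (?\<Psi> i x) powr p)
          = a j j * cmod (h x) powr (2 * p) + 2 * (W x * cmod (h x) powr p)
            + (\<Sum>k\<in>UNIV - {j}. \<Sum>i\<in>UNIV - {j}. a k i * cmod (\<Phi> k x) powr p * cmod (\<Phi> i x) powr p)"
        unfolding pp by (simp add: algebra_simps)
      show ?thesis unfolding 1 2 R_def by (simp add: algebra_simps add_divide_distrib)
    qed
    then have "energy p a ?\<Psi> = (LINT x|lborel. (cmod (weak_derivative h x))\<^sup>2
        - 1 / p * (a j j * cmod (h x) powr (2 * p) + 2 * (W x * cmod (h x) powr p)) + R x)"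
      unfolding energy_def by presburger
    also have "\<dots> = component_energy p (a j j) W h + (LINT x|lborel. R x)"
      unfolding component_energy_def using wd[OF h] i1 i2 intR by simp
    finally show ?thesis .
  qed
  then show ?thesis using that unfolding W_def[abs_def] by blast
qed

text \<open>Replacing one component by a function of equal norm stays in the constraint set, so a
  joint minimizer minimizes in each component separately. \<open>K\<close> comes from a common bound
  on the three components.\<close>

lemma minimizer_component:
  fixes \<Phi> :: "3 \<Rightarrow> real \<Rightarrow> complex"
  assumes p: "2 \<le> p" and a_pos: "\<And>k j. a k j > 0" and sym: "\<And>k j. a k j = a j k"
    and rst: "r > 0" "s > 0" "t > 0" and \<Phi>: "\<Phi> \<in> minimizers p a r s t"
  obtains K where "component_minimizer p (a j j) K (\<lambda>x. \<Sum>k\<in>UNIV - {j}. a k j * cmod (\<Phi> k x) powr p) (\<Phi> j)"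
proof -
  define W where "W x = (\<Sum>k\<in>UNIV - {j}. a k j * cmod (\<Phi> k x) powr p)" for x
  have con: "\<Phi> \<in> constraint_set r s t" and Y: "\<Phi> \<in> Y"
    using \<Phi> by (auto simp: minimizers_def constraint_set_def)
  have H: "\<Phi> i \<in> H1" for i using Y by (simp add: Y_def)
  have "\<exists>M. \<forall>i x. cmod (\<Phi> i x) \<le> M"
  proof -
    have "\<exists>M. \<forall>x. cmod (\<Phi> i x) \<le> M" for i
      using H1_bounded[OF H1D[OF H[of i]]] by blast
    then obtain M where M: "\<And>i x. cmod (\<Phi> i x) \<le> M i" by metis
    have "cmod (\<Phi> i x) \<le> (\<Sum>i\<in>UNIV. \<bar>M i\<bar>)" for i x
      using M[of i x] member_le_sum[of i UNIV "\<lambda>i. \<bar>M i\<bar>"] by fastforce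
    then show ?thesis by blast
  qed
  then obtain M where M: "\<And>i x. cmod (\<Phi> i x) \<le> M" by blast
  have W_le: "W x \<le> (\<Sum>k\<in>UNIV - {j}. a k j * M powr p)" for x
    unfolding W_def using a_pos M p by (intro sum_mono mult_left_mono powr_mono2) (auto simp: less_imp_le)
  have contW: "continuous_on UNIV W"
    unfolding W_def using p by (intro continuous_intros continuous_on_powr' H1D(1)[OF H]) auto
  obtain c where c: "\<And>h. h \<in> H1 \<Longrightarrow> energy p a (\<Phi>(j := h)) = component_energy p (a j j) W h + c"
    unfolding W_def by (rule energy_fun_upd[where a = a and j = j, OF p sym Y]) blast
  have "(norm_L2 (\<Phi> j))\<^sup>2 > 0"
    using con rst exhaust_3[of j] by (auto simp: constraint_set_def)
  then have pos: "(LINT x|lborel. (cmod (\<Phi> j x))\<^sup>2) > 0"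
    by (simp add: norm_L2_def)
  have "component_minimizer p (a j j) (\<Sum>k\<in>UNIV - {j}. a k j * M powr p) W (\<Phi> j)"
  proof
    fix h assume h: "h \<in> H1" "(LINT x|lborel. (cmod (h x))\<^sup>2) = (LINT x|lborel. (cmod (\<Phi> j x))\<^sup>2)"
    have "norm_L2 ((\<Phi>(j := h)) i) = norm_L2 (\<Phi> i)" for i
      using h(2) by (auto simp: norm_L2_eq_iff)
    moreover have "\<Phi>(j := h) \<in> Y" using Y h(1) by (auto simp: Y_def)
    ultimately have "\<Phi>(j := h) \<in> constraint_set r s t"
      using con by (simp only: constraint_set_def mem_Collect_eq)
    then have "min_energy p a r s t \<le> ereal (energy p a (\<Phi>(j := h)))"
      unfolding min_energy_def by (rule INF_lower)
    moreover have "ereal (energy p a \<Phi>) = min_energy p a r s t"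
      using \<Phi> by (simp add: minimizers_def)
    ultimately have "energy p a \<Phi> \<le> energy p a (\<Phi>(j := h))"
      by (metis ereal_less_eq(3))
    then show "component_energy p (a j j) W (\<Phi> j) \<le> component_energy p (a j j) W h"
      using c[OF h(1)] c[OF H[of j]] by simp
  qed (use p a_pos contW W_le H pos in \<open>auto simp: W_def less_imp_le intro!: sum_nonneg\<close>)
  then show ?thesis using that unfolding W_def[abs_def] by blast
qed

theorem theorem3p7:
  fixes p r s t :: real
    and a :: "3 \<Rightarrow> 3 \<Rightarrow> real"
    and \<Phi> :: "3 \<Rightarrow> real \<Rightarrow> complex"
  assumes "2 \<le> p" and "p < 3"
    and "\<And>k j. a k j > 0"
    and "\<And>k j. a k j = a j k"
    and "r > 0" and "s > 0" and "t > 0"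
    and "\<Phi> \<in> minimizers p a r s t"
  shows "(\<exists>(\<theta> :: 3 \<Rightarrow> real) (\<phi> :: 3 \<Rightarrow> real \<Rightarrow> real).
            \<forall>j. (\<forall>x. \<phi> j x > 0) \<and>
                (\<forall>x. \<Phi> j x = exp (\<i> * complex_of_real (\<theta> j)) * complex_of_real (\<phi> j x)))
         \<and> (\<forall>j. infinitely_differentiable (\<Phi> j))"
proof -
  define \<phi> where "\<phi> j x = cmod (\<Phi> j x)" for j x
  \<comment> \<open>The \<open>potential\<close> of the j-th component in terms of the moduli alone:
    the phases drop out, so the three equations form a closed real system.\<close>
  define V where "V j x = a j j * \<phi> j x powr (2 * p - 2)
    + (\<Sum>k\<in>UNIV - {j}. a k j * \<phi> k x powr p) * \<phi> j x powr (p - 2)" for j x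
  note minimizer = minimizer_component[where a = a, OF assms(1,3,4,5,6,7,8)]
  have "\<exists>\<theta>. \<forall>x. \<Phi> j x = exp (\<i> * complex_of_real \<theta>) * complex_of_real (\<phi> j x)" for j
  proof -
    obtain K where "component_minimizer p (a j j) K (\<lambda>x. \<Sum>k\<in>UNIV - {j}. a k j * cmod (\<Phi> k x) powr p) (\<Phi> j)"
      by (rule minimizer)
    then interpret component_minimizer p "a j j" K "\<lambda>x. \<Sum>k\<in>UNIV - {j}. a k j * cmod (\<Phi> k x) powr p" "\<Phi> j" .
    show ?thesis using constant_phase unfolding \<phi>_def by blast
  qed
  then obtain \<theta> where \<theta>: "\<And>j x. \<Phi> j x = exp (\<i> * complex_of_real (\<theta> j)) * complex_of_real (\<phi> j x)"
    by metis
  have "\<exists>\<omega> \<phi>'. \<forall>x. \<phi> j x > 0 \<and> (\<phi> j has_real_derivative \<phi>' x) (at x)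
      \<and> (\<phi>' has_real_derivative (\<omega> - V j x) * \<phi> j x) (at x)" for j
  proof -
    obtain K where "component_minimizer p (a j j) K (\<lambda>x. \<Sum>k\<in>UNIV - {j}. a k j * cmod (\<Phi> k x) powr p) (\<Phi> j)"
      by (rule minimizer)
    then interpret component_minimizer p "a j j" K "\<lambda>x. \<Sum>k\<in>UNIV - {j}. a k j * cmod (\<Phi> k x) powr p" "\<Phi> j" .
    have "potential = V j" by (simp add: fun_eq_iff potential_def V_def \<phi>_def)
    then show ?thesis using modulus_ode unfolding \<phi>_def[abs_def] by metis
  qed
  then obtain \<omega> \<phi>' where pos: "\<And>j x. \<phi> j x > 0" and d: "\<And>j x. (\<phi> j has_real_derivative \<phi>' j x) (at x)"
    and d2: "\<And>j x. (\<phi>' j has_real_derivative (\<omega> j - V j x) * \<phi> j x) (at x)"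
    by metis
  \<comment> \<open>By positivity, \<phi> j is its own power with exponent 1.\<close>
  have alg: "ode_algebra \<phi> \<phi>' (\<phi> j)" for j
    using ode_algebra.powr[of \<phi> \<phi>' j 1] pos[of j] by (simp add: less_imp_le)
  \<comment> \<open>The algebra is generated by sums and products, so the difference is written with
    the constant factor -1.\<close>
  have "ode_algebra \<phi> \<phi>' (\<lambda>x. (\<omega> j + (- 1) * V j x) * \<phi> j x)" for j
    unfolding V_def
    by (intro ode_algebra.mult ode_algebra.add ode_algebra.const ode_algebra.powr ode_algebra_sum alg) auto
  then have alg2: "ode_algebra \<phi> \<phi>' (\<lambda>x. (\<omega> j - V j x) * \<phi> j x)" for j
    by simp
  have "infinitely_differentiable (\<phi> j)" for j
    by (rule ode_algebra_smooth[OF pos d d2 alg2 alg])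
  \<comment> \<open>Multiplication by a constant phase is linear, so smoothness passes from the
    modulus to the component.\<close>
  then have "infinitely_differentiable (\<lambda>x. exp (\<i> * complex_of_real (\<theta> j)) * complex_of_real (\<phi> j x))" for j
    by (rule infinitely_differentiable_compose_linear)
       (intro bounded_linear_const_mult bounded_linear_of_real)
  moreover have "\<Phi> j = (\<lambda>x. exp (\<i> * complex_of_real (\<theta> j)) * complex_of_real (\<phi> j x))" for j
    by (rule ext) (rule \<theta>)
  ultimately have "infinitely_differentiable (\<Phi> j)" for j by metis
  with pos \<theta> show ?thesis by blast
qed

end
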